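(* Let $\lambda=\lambda(t)$ depend on $t$ only, belong to $\mathcal G_{L^0}(\Omega,\mathbb R)$ and be of almost certain local $L^1$-type. Let $u_0\in\mathcal G_{L^0}(\Omega,\mathbb R)$. Then the scalar problem $$(\partial_t+\lambda(t)\partial_x)u(x,t)=0,\qquad u(x,0)=u_0(x)$$ has a unique solution $u\in\mathcal G_{L^0}(\Omega,\mathbb R^2)$. (The differential equation is understood as an equality in $\mathcal G_{L^0}(\Omega,\mathbb R^2)$ and the initial condition as an equality in $\mathcal G_{L^0}(\Omega,\mathbb R)$.)
   Context: $(\Omega,\Sigma,P)$ is a probability space (assumed complete whenever needed). A random field on $\mathbb R^d$ is a map $\mathbb R^d\times\Omega\to\mathbb R$, $(x,\omega)\mapsto A(x,\omega)$, such that $\omega\mapsto A(x,\omega)$ is measurable for every $x$. A family $(r_\varepsilon)_{\varepsilon\in(0,1]}$ of numbers is moderate if $\exists a\ge 0:\ |r_\varepsilon|=O(\varepsilon^{-a})$ as $\varepsilon\to0$, and negligible if $\forall b\ge0:\ |r_\varepsilon|=O(\varepsilon^{b})$ as $\varepsilon\to 0$. A family $(u_\varepsilon)_{\varepsilon\in(0,1]}$ of functions in $\mathcal C^\infty(\mathbb R^d)$ is moderate, written $(u_\varepsilon)\in\mathcal E_M(\mathbb R^d)$ (respectively negligible, written $(u_\varepsilon)\in\mathcal N(\mathbb R^d)$), if for all compact $K\subset\mathbb R^d$ and all $\alpha\in\mathbb N_0^d$ the family $(\sup_{x\in K}|\partial^\alpha u_\varepsilon(x)|)_{\varepsilon}$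 is moderate (respectively negligible). $\mathcal E_{M,L^0}(\Omega,\mathbb R^d)$ is the set of families $(u_\varepsilon)_{\varepsilon\in(0,1]}$ of random fields on $\mathbb R^d$ such that: for almost all $\omega$ and all $\varepsilon\in(0,1]$, $x\mapsto u_\varepsilon(x,\omega)$ is in $\mathcal C^\infty(\mathbb R^d)$; for all $x,\varepsilon$, $\omega\mapsto u_\varepsilon(x,\omega)$ is measurable; and for almost all $\omega$, $(u_\varepsilon(\cdot,\omega))_\varepsilon\in\mathcal E_M(\mathbb R^d)$. $\mathcal N_{L^0}(\Omega,\mathbb R^d)$ is defined in the same way with $\mathcal N(\mathbb R^d)$ in place of $\mathcal E_M(\mathbb R^d)$. $\mathcal G_{L^0}(\Omega,\mathbb R^d)=\mathcal E_{M,L^0}(\Omega,\mathbb R^d)/\mathcal N_{L^0}(\Omega,\mathbb R^d)$; it is a differential algebra with operations defined on representatives. The restriction of $u\in\mathcal G_{L^0}(\Omega,\mathbb R^2)$ to $t=0$ is the class of $(u_\varepsilon(\cdot,0,\cdot))_\varepsilon$ in $\mathcal G_{L^0}(\Omega,\mathbb R)$. A process $v\in\mathcal G_{L^0}(\Omega,\mathbb R)$ is of almost certain local $L^1$-type if it has a representative such that for every compact $K\subset\mathbb R$ and almost all $\omega$ there is $c(\omega)>0$ such that, for all $\varepsilon\in(0,1]$, $\int_K|v_\varepsilon(t,\omega)|\,dt\le c(\omega)$. *)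

theory Defs
  imports "HOL-Probability.Probability" "HOL-Library.Landau_Symbols"
begin

text \<open>
  The space $R^d$ is rendered by a type of class \<open>euclidean_space\<close>; the theorem uses \<open>real\<close>
  for $d = 1$ and \<open>real \<times> real\<close>, with points \<open>(x, t)\<close>, for $d = 2$. Families indexed by
  $(0,1]$ are total functions on \<open>real\<close> whose values outside \<open>{0<..1}\<close> are never constrained;
  equivalence classes therefore do not see these values.
\<close>

definition partial_deriv :: "'a::euclidean_space \<Rightarrow> ('a \<Rightarrow> real) \<Rightarrow> 'a \<Rightarrow> real" where
  "partial_deriv b f x = deriv (\<lambda>h. f (x + h *\<^sub>R b)) 0"

text \<open>
  Mixed partial derivatives are indexed by words in the basis vectors rather than by
  multi-indices; every multi-index is represented by a word, and for smooth functions the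
  order of the letters is immaterial.
\<close>

definition partial_derivs :: "'a::euclidean_space list \<Rightarrow> ('a \<Rightarrow> real) \<Rightarrow> 'a \<Rightarrow> real" where
  "partial_derivs bs f = foldr partial_deriv bs f"

definition C_infinity :: "('a::euclidean_space \<Rightarrow> real) set" where
  "C_infinity = {f. \<forall>bs\<in>lists Basis. continuous_on UNIV (partial_derivs bs f) \<and>
     (\<forall>b\<in>Basis. \<forall>x. (\<lambda>h. partial_derivs bs f (x + h *\<^sub>R b)) field_differentiable at 0)}"

definition moderate :: "(real \<Rightarrow> real) \<Rightarrow> bool" where
  "moderate r \<longleftrightarrow> (\<exists>a\<ge>0. r \<in> O[at_right 0](\<lambda>\<epsilon>. \<epsilon> powr (- a)))"

definition negligible_net :: "(real \<Rightarrow> real) \<Rightarrow> bool" where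
  "negligible_net r \<longleftrightarrow> (\<forall>b\<ge>0. r \<in> O[at_right 0](\<lambda>\<epsilon>. \<epsilon> powr b))"

text \<open>The empty compact set is excluded only because \<open>Sup {}\<close> is unspecified on \<open>real\<close>.\<close>

definition E_M :: "(real \<Rightarrow> 'a::euclidean_space \<Rightarrow> real) set" where
  "E_M = {u. (\<forall>\<epsilon>\<in>{0<..1}. u \<epsilon> \<in> C_infinity) \<and>
     (\<forall>K. compact K \<and> K \<noteq> {} \<longrightarrow>
       (\<forall>bs\<in>lists Basis. moderate (\<lambda>\<epsilon>. SUP x\<in>K. \<bar>partial_derivs bs (u \<epsilon>) x\<bar>)))}"

definition N_null :: "(real \<Rightarrow> 'a::euclidean_space \<Rightarrow> real) set" where
  "N_null = {u. (\<forall>\<epsilon>\<in>{0<..1}. u \<epsilon> \<in> C_infinity) \<and>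
     (\<forall>K. compact K \<and> K \<noteq> {} \<longrightarrow>
       (\<forall>bs\<in>lists Basis. negligible_net (\<lambda>\<epsilon>. SUP x\<in>K. \<bar>partial_derivs bs (u \<epsilon>) x\<bar>)))}"

text \<open>The arguments of a family of random fields are, in this order, \<open>\<epsilon>\<close>, \<open>x\<close> and \<open>\<omega>\<close>.\<close>

type_synonym ('a, 'w) rfields = "real \<Rightarrow> 'a \<Rightarrow> 'w \<Rightarrow> real"

definition E_ML0 :: "'w measure \<Rightarrow> ('a::euclidean_space, 'w) rfields set" where
  "E_ML0 P = {u. (AE \<omega> in P. \<forall>\<epsilon>\<in>{0<..1}. (\<lambda>x. u \<epsilon> x \<omega>) \<in> C_infinity) \<and>
     (\<forall>x. \<forall>\<epsilon>\<in>{0<..1}. (\<lambda>\<omega>. u \<epsilon> x \<omega>) \<in> borel_measurable P) \<and>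
     (AE \<omega> in P. (\<lambda>\<epsilon> x. u \<epsilon> x \<omega>) \<in> E_M)}"

definition N_L0 :: "'w measure \<Rightarrow> ('a::euclidean_space, 'w) rfields set" where
  "N_L0 P = {u. (AE \<omega> in P. \<forall>\<epsilon>\<in>{0<..1}. (\<lambda>x. u \<epsilon> x \<omega>) \<in> C_infinity) \<and>
     (\<forall>x. \<forall>\<epsilon>\<in>{0<..1}. (\<lambda>\<omega>. u \<epsilon> x \<omega>) \<in> borel_measurable P) \<and>
     (AE \<omega> in P. (\<lambda>\<epsilon> x. u \<epsilon> x \<omega>) \<in> N_null)}"

definition L0_rel ::
    "'w measure \<Rightarrow> (('a::euclidean_space, 'w) rfields \<times> ('a, 'w) rfields) set" where
  "L0_rel P = {(u, v). u \<in> E_ML0 P \<and> v \<in> E_ML0 P \<and> (\<lambda>\<epsilon> x \<omega>. u \<epsilon> x \<omega> - v \<epsilon> x \<omega>) \<in> N_L0 P}"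

definition G_L0 :: "'w measure \<Rightarrow> ('a::euclidean_space, 'w) rfields set set" where
  "G_L0 P = E_ML0 P // L0_rel P"

definition G_class ::
    "'w measure \<Rightarrow> ('a::euclidean_space, 'w) rfields \<Rightarrow> ('a, 'w) rfields set" where
  "G_class P u = L0_rel P `` {u}"

text \<open>
  Operations on classes are given by representatives, as the union of the classes obtained
  from all choices of representatives (a single class, since the operations respect
  \<open>L0_rel\<close>).
\<close>

definition G_zero :: "'w measure \<Rightarrow> ('a::euclidean_space, 'w) rfields set" where
  "G_zero P = G_class P (\<lambda>\<epsilon> x \<omega>. 0)"

definition G_add :: "'w measure \<Rightarrow> ('a::euclidean_space, 'w) rfields set \<Rightarrow>
    ('a, 'w) rfields set \<Rightarrow> ('a, 'w) rfields set" where
  "G_add P U V = (\<Union>u\<in>U. \<Union>v\<in>V. G_class P (\<lambda>\<epsilon> x \<omega>. u \<epsilon> x \<omega> + v \<epsilon> x \<omega>))"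

definition G_mult :: "'w measure \<Rightarrow> ('a::euclidean_space, 'w) rfields set \<Rightarrow>
    ('a, 'w) rfields set \<Rightarrow> ('a, 'w) rfields set" where
  "G_mult P U V = (\<Union>u\<in>U. \<Union>v\<in>V. G_class P (\<lambda>\<epsilon> x \<omega>. u \<epsilon> x \<omega> * v \<epsilon> x \<omega>))"

text \<open>
  On the null set where a path is not smooth, \<open>partial_deriv\<close> may take arbitrary values;
  measurability of the derivative in \<open>\<omega>\<close> there relies on completeness of \<open>P\<close>.
\<close>

definition G_deriv :: "'w measure \<Rightarrow> 'a::euclidean_space \<Rightarrow> ('a, 'w) rfields set \<Rightarrow>
    ('a, 'w) rfields set" where
  "G_deriv P b U = (\<Union>u\<in>U. G_class P (\<lambda>\<epsilon> x \<omega>. partial_deriv b (\<lambda>y. u \<epsilon> y \<omega>) x))"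

definition G_restrict_t0 :: "'w measure \<Rightarrow> (real \<times> real, 'w) rfields set \<Rightarrow>
    (real, 'w) rfields set" where
  "G_restrict_t0 P U = (\<Union>u\<in>U. G_class P (\<lambda>\<epsilon> x \<omega>. u \<epsilon> (x, 0) \<omega>))"

text \<open>A generalized process in \<open>t\<close>, viewed as a generalized random field in \<open>(x, t)\<close>.\<close>

definition G_of_t :: "'w measure \<Rightarrow> (real, 'w) rfields set \<Rightarrow>
    (real \<times> real, 'w) rfields set" where
  "G_of_t P V = (\<Union>v\<in>V. G_class P (\<lambda>\<epsilon> (x, t) \<omega>. v \<epsilon> t \<omega>))"

definition ac_local_L1_type :: "'w measure \<Rightarrow> (real, 'w) rfields set \<Rightarrow> bool" where
  "ac_local_L1_type P V \<longleftrightarrow> (\<exists>v\<in>V. \<forall>K. compact K \<longrightarrow>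
     (AE \<omega> in P. \<exists>c>0. \<forall>\<epsilon>\<in>{0<..1}.
        (\<integral>\<^sup>+ t\<in>K. ennreal \<bar>v \<epsilon> t \<omega>\<bar> \<partial>lborel) \<le> ennreal c))"

end

theory Submission imports Defs begin

text \<open>
  Let \<open>\<Lambda>\<^sub>\<epsilon>\<close> be the antiderivative of \<open>\<lambda>\<^sub>\<epsilon>\<close> vanishing at \<open>0\<close>. The \<open>L\<^sup>1\<close>-type assumption implies
  that, over compact time intervals, the characteristics \<open>s \<mapsto> x - \<Lambda>\<^sub>\<epsilon> t + \<Lambda>\<^sub>\<epsilon> s\<close> stay in a compact set uniformly in \<open>\<epsilon>\<close>,
  so that \<open>u\<^sub>0 (x - \<Lambda>\<^sub>\<epsilon> t)\<close> is moderate; it solves the problem pathwise and exactly. For uniqueness,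
  the difference of two solutions is bounded on compact sets by integrating the negligible residual
  along characteristics; for moderate nets negligibility of the derivatives is then automatic.
  Measurability of \<open>\<Lambda>\<^sub>\<epsilon>\<close> and of the composition comes from joint measurability of fields with
  continuous paths.
\<close>

section \<open>Growth conditions\<close>

text \<open>The obstacle is that moderateness controls a net only over compact sets. If the
  antiderivative were merely moderate, the initial datum would be sampled at points that may escape
  to infinity as \<epsilon> tends to 0, where no moderate bound is at hand. What has to be bounded
  uniformly in \<epsilon> is only the antiderivative itself; its derivatives are those of \<lambda>
  and may grow like powers of \<open>1/\<epsilon>\<close>. All mixed derivatives of the composition
  are reached without a higher chain rule: sums and products of transported nets and of nets in
  \<open>t\<close> alone form an algebra stable under both partial derivatives, since a
  \<open>t\<close>-derivative merely produces a factor \<open>-\<lambda>\<^sub>\<epsilon> t\<close>.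
  Negligibility of derivatives being automatic, well-definedness of the operations on classes and
  uniqueness both become estimates of order zero. The analysis is done for a fixed \<omega> outside
  a null set; completeness of the measure brings the results back to measurable fields.\<close>

lemma at_right_zero_less: "0 < c \<Longrightarrow> \<forall>\<^sub>F \<epsilon> in at_right (0::real). 0 < \<epsilon> \<and> \<epsilon> < c"
  using eventually_at_right_real[of 0 c] by simp

text \<open>Writing the bound as a product with a natural power avoids negative exponents and lets
  exponents simply add when nets are multiplied.\<close>

lemma moderate_iff:
  "moderate r \<longleftrightarrow> (\<exists>N::nat. \<forall>\<^sub>F \<epsilon> in at_right 0. \<bar>r \<epsilon>\<bar> * \<epsilon> ^ N \<le> 1)"
proof
  assume "moderate r"
  then obtain a where a: "a \<ge> 0" "r \<in> O[at_right 0](\<lambda>\<epsilon>. \<epsilon> powr (- a))"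
    unfolding moderate_def by blast
  from a(2) obtain c where c: "c > 0"
      "\<forall>\<^sub>F \<epsilon> in at_right 0. norm (r \<epsilon>) \<le> c * norm (\<epsilon> powr (- a))"
    by (elim landau_o.bigE)
  then have c': "0 < 1 / c" by simp
  \<comment> \<open>The spare unit of exponent leaves a factor \<epsilon>, which absorbs
    \<open>c\<close> as soon as \<open>\<epsilon> < 1 / c\<close>.\<close>
  obtain N :: nat where N: "a + 1 \<le> N" using real_arch_simple by blast
  have "\<forall>\<^sub>F \<epsilon> in at_right 0. \<bar>r \<epsilon>\<bar> * \<epsilon> ^ N \<le> 1"
    using c(2) at_right_zero_less[OF zero_less_one] at_right_zero_less[OF c']
  proof eventually_elim
    case (elim \<epsilon>)
    then have e: "0 < \<epsilon>" "\<epsilon> < 1" "\<epsilon> < 1 / c" by auto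
    have "\<bar>r \<epsilon>\<bar> * \<epsilon> ^ N \<le> c * \<epsilon> powr (- a) * \<epsilon> ^ N"
      using elim e by (intro mult_right_mono) auto
    also have "\<dots> = c * \<epsilon> powr (N - a)"
      using e by (simp add: powr_realpow[symmetric] powr_add[symmetric])
    also have "\<dots> \<le> c * \<epsilon> powr 1"
      using e N c(1) by (intro mult_left_mono powr_mono') auto
    also have "\<dots> \<le> 1" using e c(1) by (simp add: field_simps)
    finally show ?case .
  qed
  then show "\<exists>N::nat. \<forall>\<^sub>F \<epsilon> in at_right 0. \<bar>r \<epsilon>\<bar> * \<epsilon> ^ N \<le> 1" by blast
next
  assume "\<exists>N::nat. \<forall>\<^sub>F \<epsilon> in at_right 0. \<bar>r \<epsilon>\<bar> * \<epsilon> ^ N \<le> 1"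
  then obtain N :: nat where N: "\<forall>\<^sub>F \<epsilon> in at_right 0. \<bar>r \<epsilon>\<bar> * \<epsilon> ^ N \<le> 1" by blast
  have "r \<in> O[at_right 0](\<lambda>\<epsilon>. \<epsilon> powr (- real N))"
  proof (rule bigoI[where c = 1])
    show "\<forall>\<^sub>F \<epsilon> in at_right 0. norm (r \<epsilon>) \<le> 1 * norm (\<epsilon> powr (- real N))"
      using N at_right_zero_less[OF zero_less_one]
    proof eventually_elim
      case (elim \<epsilon>)
      then show ?case by (simp add: powr_minus powr_realpow field_simps)
    qed
  qed
  then show "moderate r" unfolding moderate_def by (intro exI[of _ "real N"]) simp
qed

lemma negligible_net_iff:
  "negligible_net r \<longleftrightarrow> (\<forall>N::nat. \<forall>\<^sub>F \<epsilon> in at_right 0. \<bar>r \<epsilon>\<bar> \<le> \<epsilon> ^ N)"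
proof (intro iffI allI)
  fix N :: nat
  assume "negligible_net r"
  then have "r \<in> O[at_right 0](\<lambda>\<epsilon>. \<epsilon> powr (real (Suc N)))"
    unfolding negligible_net_def by (auto dest: spec[of _ "real (Suc N)"])
  then obtain c where c: "c > 0"
      "\<forall>\<^sub>F \<epsilon> in at_right 0. norm (r \<epsilon>) \<le> c * norm (\<epsilon> powr (real (Suc N)))"
    by (elim landau_o.bigE)
  then have c': "0 < 1 / c" by simp
  show "\<forall>\<^sub>F \<epsilon> in at_right 0. \<bar>r \<epsilon>\<bar> \<le> \<epsilon> ^ N"
    using c(2) at_right_zero_less[OF c']
  proof eventually_elim
    case (elim \<epsilon>)
    then have e: "0 < \<epsilon>" "\<epsilon> < 1 / c" by auto
    have "\<bar>r \<epsilon>\<bar> \<le> c * \<epsilon> ^ Suc N" using elim e powr_realpow[of \<epsilon> "Suc N"] by simp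
    also have "\<dots> = (c * \<epsilon>) * \<epsilon> ^ N" by simp
    also have "\<dots> \<le> 1 * \<epsilon> ^ N"
      using e c(1) by (intro mult_right_mono) (auto simp: field_simps)
    finally show ?case by simp
  qed
next
  assume r: "\<forall>N::nat. \<forall>\<^sub>F \<epsilon> in at_right 0. \<bar>r \<epsilon>\<bar> \<le> \<epsilon> ^ N"
  show "negligible_net r" unfolding negligible_net_def
  proof (intro allI impI)
    fix b :: real assume "b \<ge> 0"
    obtain N :: nat where N: "b \<le> N" using real_arch_simple by blast
    show "r \<in> O[at_right 0](\<lambda>\<epsilon>. \<epsilon> powr b)"
    proof (rule bigoI[where c = 1])
      show "\<forall>\<^sub>F \<epsilon> in at_right 0. norm (r \<epsilon>) \<le> 1 * norm (\<epsilon> powr b)"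
        using r[THEN spec, of N] at_right_zero_less[OF zero_less_one]
      proof eventually_elim
        case (elim \<epsilon>)
        then have "\<epsilon> powr N \<le> \<epsilon> powr b" using N by (intro powr_mono') auto
        with elim show ?case by (simp add: powr_realpow)
      qed
    qed
  qed
qed

text \<open>
  The constants hidden in the Landau symbols are absorbed by raising the exponent, so integer
  exponents and constant \<open>1\<close> suffice.
\<close>

definition loc_moderate :: "(real \<Rightarrow> 'a::euclidean_space \<Rightarrow> real) \<Rightarrow> bool" where
  "loc_moderate u \<longleftrightarrow>
     (\<forall>K. compact K \<longrightarrow> (\<exists>N::nat. \<forall>\<^sub>F \<epsilon> in at_right 0. \<forall>x\<in>K. \<bar>u \<epsilon> x\<bar> * \<epsilon> ^ N \<le> 1))"

definition loc_negligible :: "(real \<Rightarrow> 'a::euclidean_space \<Rightarrow> real) \<Rightarrow> bool" where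
  "loc_negligible u \<longleftrightarrow>
     (\<forall>K. compact K \<longrightarrow> (\<forall>N::nat. \<forall>\<^sub>F \<epsilon> in at_right 0. \<forall>x\<in>K. \<bar>u \<epsilon> x\<bar> \<le> \<epsilon> ^ N))"

text \<open>Compactness and continuity bound the image, so that \<open>SUP\<close> on the reals is a
  genuine supremum; it is nonnegative because \<open>K\<close> is nonempty, hence the outer absolute
  value is harmless.\<close>

lemma abs_SUP_abs_le_iff:
  fixes f :: "'a::topological_space \<Rightarrow> real"
  assumes "compact K" "K \<noteq> {}" "continuous_on K f"
  shows "\<bar>SUP x\<in>K. \<bar>f x\<bar>\<bar> \<le> c \<longleftrightarrow> (\<forall>x\<in>K. \<bar>f x\<bar> \<le> c)"
proof -
  have bdd: "bdd_above ((\<lambda>x. \<bar>f x\<bar>) ` K)"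
    using assms
    by (intro bounded_imp_bdd_above compact_imp_bounded compact_continuous_image continuous_intros)
  obtain x where x: "x \<in> K" using assms by blast
  have "0 \<le> \<bar>f x\<bar>" by simp
  also have "\<dots> \<le> (SUP x\<in>K. \<bar>f x\<bar>)" by (rule cSUP_upper[OF x bdd])
  finally show ?thesis using cSUP_le_iff[OF assms(2) bdd] by simp
qed

lemma moderate_SUP_iff:
  assumes "\<And>\<epsilon>. \<epsilon> \<in> {0<..1} \<Longrightarrow> continuous_on UNIV (u \<epsilon>)"
  shows "(\<forall>K. compact K \<and> K \<noteq> {} \<longrightarrow> moderate (\<lambda>\<epsilon>. SUP x\<in>K. \<bar>u \<epsilon> x\<bar>)) \<longleftrightarrow> loc_moderate u"
proof -
  have "moderate (\<lambda>\<epsilon>. SUP x\<in>K. \<bar>u \<epsilon> x\<bar>) \<longleftrightarrow>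
      (\<exists>N::nat. \<forall>\<^sub>F \<epsilon> in at_right 0. \<forall>x\<in>K. \<bar>u \<epsilon> x\<bar> * \<epsilon> ^ N \<le> 1)"
    if K: "compact K" "K \<noteq> {}" for K
  proof -
    have "(\<forall>\<^sub>F \<epsilon> in at_right 0. \<bar>SUP x\<in>K. \<bar>u \<epsilon> x\<bar>\<bar> * \<epsilon> ^ N \<le> 1) \<longleftrightarrow>
        (\<forall>\<^sub>F \<epsilon> in at_right 0. \<forall>x\<in>K. \<bar>u \<epsilon> x\<bar> * \<epsilon> ^ N \<le> 1)" for N :: nat
    proof (rule eventually_cong[OF at_right_zero_less[OF zero_less_one]])
      fix \<epsilon> :: real assume e: "0 < \<epsilon> \<and> \<epsilon> < 1"
      have "\<bar>SUP x\<in>K. \<bar>u \<epsilon> x\<bar>\<bar> \<le> 1 / \<epsilon> ^ N \<longleftrightarrow> (\<forall>x\<in>K. \<bar>u \<epsilon> x\<bar> \<le> 1 / \<epsilon> ^ N)"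
        using e assms[of \<epsilon>] K by (intro abs_SUP_abs_le_iff) (auto intro: continuous_on_subset)
      then show "\<bar>SUP x\<in>K. \<bar>u \<epsilon> x\<bar>\<bar> * \<epsilon> ^ N \<le> 1 \<longleftrightarrow> (\<forall>x\<in>K. \<bar>u \<epsilon> x\<bar> * \<epsilon> ^ N \<le> 1)"
        using e by (simp add: pos_le_divide_eq)
    qed
    then show ?thesis unfolding moderate_iff by simp
  qed
  \<comment> \<open>\<open>loc_moderate\<close> also ranges over the empty set, where its condition
    is vacuous; this matches the exclusion of that set on the left.\<close>
  then have "(compact K \<and> K \<noteq> {} \<longrightarrow> moderate (\<lambda>\<epsilon>. SUP x\<in>K. \<bar>u \<epsilon> x\<bar>)) \<longleftrightarrow>
      (compact K \<longrightarrow> (\<exists>N::nat. \<forall>\<^sub>F \<epsilon> in at_right 0. \<forall>x\<in>K. \<bar>u \<epsilon> x\<bar> * \<epsilon> ^ N \<le> 1))" for K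
    by (cases "K = {}") simp_all
  then show ?thesis unfolding loc_moderate_def by simp
qed

lemma negligible_SUP_iff:
  assumes "\<And>\<epsilon>. \<epsilon> \<in> {0<..1} \<Longrightarrow> continuous_on UNIV (u \<epsilon>)"
  shows "(\<forall>K. compact K \<and> K \<noteq> {} \<longrightarrow> negligible_net (\<lambda>\<epsilon>. SUP x\<in>K. \<bar>u \<epsilon> x\<bar>)) \<longleftrightarrow>
    loc_negligible u"
proof -
  have "negligible_net (\<lambda>\<epsilon>. SUP x\<in>K. \<bar>u \<epsilon> x\<bar>) \<longleftrightarrow>
      (\<forall>N::nat. \<forall>\<^sub>F \<epsilon> in at_right 0. \<forall>x\<in>K. \<bar>u \<epsilon> x\<bar> \<le> \<epsilon> ^ N)"
    if K: "compact K" "K \<noteq> {}" for K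
  proof -
    have "(\<forall>\<^sub>F \<epsilon> in at_right 0. \<bar>SUP x\<in>K. \<bar>u \<epsilon> x\<bar>\<bar> \<le> \<epsilon> ^ N) \<longleftrightarrow>
        (\<forall>\<^sub>F \<epsilon> in at_right 0. \<forall>x\<in>K. \<bar>u \<epsilon> x\<bar> \<le> \<epsilon> ^ N)" for N :: nat
    proof (rule eventually_cong[OF at_right_zero_less[OF zero_less_one]])
      fix \<epsilon> :: real assume e: "0 < \<epsilon> \<and> \<epsilon> < 1"
      show "\<bar>SUP x\<in>K. \<bar>u \<epsilon> x\<bar>\<bar> \<le> \<epsilon> ^ N \<longleftrightarrow> (\<forall>x\<in>K. \<bar>u \<epsilon> x\<bar> \<le> \<epsilon> ^ N)"
        using e assms[of \<epsilon>] K by (intro abs_SUP_abs_le_iff) (auto intro: continuous_on_subset)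
    qed
    then show ?thesis unfolding negligible_net_iff by simp
  qed
  then have "(compact K \<and> K \<noteq> {} \<longrightarrow> negligible_net (\<lambda>\<epsilon>. SUP x\<in>K. \<bar>u \<epsilon> x\<bar>)) \<longleftrightarrow>
      (compact K \<longrightarrow> (\<forall>N::nat. \<forall>\<^sub>F \<epsilon> in at_right 0. \<forall>x\<in>K. \<bar>u \<epsilon> x\<bar> \<le> \<epsilon> ^ N))" for K
    by (cases "K = {}") simp_all
  then show ?thesis unfolding loc_negligible_def by simp
qed

lemma loc_negligible_imp_moderate: "loc_negligible u \<Longrightarrow> loc_moderate u"
  unfolding loc_negligible_def loc_moderate_def
proof (intro allI impI exI)
  fix K :: "'a set"
  assume "\<forall>K. compact K \<longrightarrow> (\<forall>N. \<forall>\<^sub>F \<epsilon> in at_right 0. \<forall>x\<in>K. \<bar>u \<epsilon> x\<bar> \<le> \<epsilon> ^ N)" "compact K"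
  then have "\<forall>\<^sub>F \<epsilon> in at_right 0. \<forall>x\<in>K. \<bar>u \<epsilon> x\<bar> \<le> \<epsilon> ^ 0" by blast
  then show "\<forall>\<^sub>F \<epsilon> in at_right 0. \<forall>x\<in>K. \<bar>u \<epsilon> x\<bar> * \<epsilon> ^ 0 \<le> 1" by simp
qed

section \<open>Local growth conditions under sums and products\<close>

lemma loc_moderate_mult:
  assumes "loc_moderate u" "loc_moderate v"
  shows "loc_moderate (\<lambda>\<epsilon> x. u \<epsilon> x * v \<epsilon> x)"
  unfolding loc_moderate_def
proof (intro allI impI)
  fix K :: "'a set" assume K: "compact K"
  obtain M :: nat where M: "\<forall>\<^sub>F \<epsilon> in at_right 0. \<forall>x\<in>K. \<bar>u \<epsilon> x\<bar> * \<epsilon> ^ M \<le> 1"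
    using assms(1) K unfolding loc_moderate_def by blast
  obtain N :: nat where N: "\<forall>\<^sub>F \<epsilon> in at_right 0. \<forall>x\<in>K. \<bar>v \<epsilon> x\<bar> * \<epsilon> ^ N \<le> 1"
    using assms(2) K unfolding loc_moderate_def by blast
  have "\<forall>\<^sub>F \<epsilon> in at_right 0. \<forall>x\<in>K. \<bar>u \<epsilon> x * v \<epsilon> x\<bar> * \<epsilon> ^ (M + N) \<le> 1"
    using M N at_right_zero_less[OF zero_less_one]
  proof eventually_elim
    case (elim \<epsilon>)
    show ?case
    proof
      fix x assume "x \<in> K"
      then have "(\<bar>u \<epsilon> x\<bar> * \<epsilon> ^ M) * (\<bar>v \<epsilon> x\<bar> * \<epsilon> ^ N) \<le> 1 * 1"
        using elim by (intro mult_mono) auto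
      then show "\<bar>u \<epsilon> x * v \<epsilon> x\<bar> * \<epsilon> ^ (M + N) \<le> 1"
        by (simp add: abs_mult power_add mult_ac)
    qed
  qed
  then show "\<exists>N::nat. \<forall>\<^sub>F \<epsilon> in at_right 0. \<forall>x\<in>K. \<bar>u \<epsilon> x * v \<epsilon> x\<bar> * \<epsilon> ^ N \<le> 1" by blast
qed

lemma loc_moderate_add:
  assumes "loc_moderate u" "loc_moderate v"
  shows "loc_moderate (\<lambda>\<epsilon> x. u \<epsilon> x + v \<epsilon> x)"
  unfolding loc_moderate_def
proof (intro allI impI)
  fix K :: "'a set" assume K: "compact K"
  obtain M :: nat where M: "\<forall>\<^sub>F \<epsilon> in at_right 0. \<forall>x\<in>K. \<bar>u \<epsilon> x\<bar> * \<epsilon> ^ M \<le> 1"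
    using assms(1) K unfolding loc_moderate_def by blast
  obtain N :: nat where N: "\<forall>\<^sub>F \<epsilon> in at_right 0. \<forall>x\<in>K. \<bar>v \<epsilon> x\<bar> * \<epsilon> ^ N \<le> 1"
    using assms(2) K unfolding loc_moderate_def by blast
  have "\<forall>\<^sub>F \<epsilon> in at_right 0. \<forall>x\<in>K. \<bar>u \<epsilon> x + v \<epsilon> x\<bar> * \<epsilon> ^ (Suc (M + N)) \<le> 1"
    \<comment> \<open>Two bounds by 1 add up to 2; the additional power of \<epsilon> in the claim,
      with \<open>\<epsilon> < 1/2\<close>, brings this back to 1.\<close>
    using M N at_right_zero_less[of "1/2", simplified]
  proof eventually_elim
    case (elim \<epsilon>)
    show ?case
    proof
      fix x assume x: "x \<in> K"
      have "\<bar>u \<epsilon> x\<bar> * \<epsilon> ^ M * \<epsilon> ^ N \<le> 1 * 1" "\<bar>v \<epsilon> x\<bar> * \<epsilon> ^ N * \<epsilon> ^ M \<le> 1 * 1"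
        using elim x by (intro mult_mono power_le_one; auto)+
      then have "\<bar>u \<epsilon> x\<bar> * \<epsilon> ^ (M + N) + \<bar>v \<epsilon> x\<bar> * \<epsilon> ^ (M + N) \<le> 2"
        by (simp add: power_add mult_ac)
      moreover have "\<bar>u \<epsilon> x + v \<epsilon> x\<bar> * \<epsilon> ^ (M + N) \<le>
          \<bar>u \<epsilon> x\<bar> * \<epsilon> ^ (M + N) + \<bar>v \<epsilon> x\<bar> * \<epsilon> ^ (M + N)"
        unfolding distrib_right[symmetric] using elim by (intro mult_right_mono) auto
      ultimately have "\<epsilon> * (\<bar>u \<epsilon> x + v \<epsilon> x\<bar> * \<epsilon> ^ (M + N)) \<le> (1/2) * 2"
        using elim by (intro mult_mono) auto
      then show "\<bar>u \<epsilon> x + v \<epsilon> x\<bar> * \<epsilon> ^ (Suc (M + N)) \<le> 1" by (simp add: mult_ac)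
    qed
  qed
  then show "\<exists>N::nat. \<forall>\<^sub>F \<epsilon> in at_right 0. \<forall>x\<in>K. \<bar>u \<epsilon> x + v \<epsilon> x\<bar> * \<epsilon> ^ N \<le> 1" by blast
qed

lemma loc_moderate_const: "loc_moderate (\<lambda>\<epsilon> x. c)"
proof -
  have "\<forall>\<^sub>F \<epsilon> in at_right 0. \<bar>c\<bar> * \<epsilon> ^ 1 \<le> 1"
    using at_right_zero_less[of "1 / (1 + \<bar>c\<bar>)", simplified]
  proof (rule eventually_mono)
    show "\<bar>c\<bar> * \<epsilon> ^ 1 \<le> 1" if "0 < \<epsilon> \<and> \<epsilon> < 1 / (1 + \<bar>c\<bar>)" for \<epsilon>
    proof -
      have "(1 + \<bar>c\<bar>) * \<epsilon> < 1" using that by (simp add: pos_less_divide_eq mult.commute)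
      then show ?thesis using that by (simp add: algebra_simps)
    qed
  qed (simp add: add_pos_nonneg)
  then show ?thesis unfolding loc_moderate_def by (auto intro!: exI[of _ 1])
qed

lemma loc_negligible_mult:
  assumes "loc_negligible u" "loc_moderate v"
  shows "loc_negligible (\<lambda>\<epsilon> x. u \<epsilon> x * v \<epsilon> x)"
  unfolding loc_negligible_def
proof (intro allI impI)
  fix K :: "'a set" and n :: nat assume K: "compact K"
  obtain N :: nat where N: "\<forall>\<^sub>F \<epsilon> in at_right 0. \<forall>x\<in>K. \<bar>v \<epsilon> x\<bar> * \<epsilon> ^ N \<le> 1"
    using assms K unfolding loc_moderate_def by blast
  have "\<forall>\<^sub>F \<epsilon> in at_right 0. \<forall>x\<in>K. \<bar>u \<epsilon> x\<bar> \<le> \<epsilon> ^ (n + N)"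
    using assms K unfolding loc_negligible_def by blast
  then show "\<forall>\<^sub>F \<epsilon> in at_right 0. \<forall>x\<in>K. \<bar>u \<epsilon> x * v \<epsilon> x\<bar> \<le> \<epsilon> ^ n"
    using N at_right_zero_less[OF zero_less_one]
  proof eventually_elim
    case (elim \<epsilon>)
    show ?case
    proof
      fix x assume x: "x \<in> K"
      have "\<bar>u \<epsilon> x * v \<epsilon> x\<bar> \<le> \<epsilon> ^ (n + N) * \<bar>v \<epsilon> x\<bar>"
        unfolding abs_mult using elim x by (intro mult_right_mono) auto
      \<comment> \<open>Asking \<open>u\<close> for the exponent \<open>n + N\<close> pays in
        advance for the growth of \<open>v\<close>.\<close>
      also have "\<dots> = \<epsilon> ^ n * (\<bar>v \<epsilon> x\<bar> * \<epsilon> ^ N)" by (simp add: power_add)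
      also have "\<dots> \<le> \<epsilon> ^ n * 1" using elim x by (intro mult_left_mono) auto
      finally show "\<bar>u \<epsilon> x * v \<epsilon> x\<bar> \<le> \<epsilon> ^ n" by simp
    qed
  qed
qed

lemma loc_negligible_add:
  assumes "loc_negligible u" "loc_negligible v"
  shows "loc_negligible (\<lambda>\<epsilon> x. u \<epsilon> x + v \<epsilon> x)"
  unfolding loc_negligible_def
proof (intro allI impI)
  fix K :: "'a set" and n :: nat assume K: "compact K"
  have "\<forall>\<^sub>F \<epsilon> in at_right 0. \<forall>x\<in>K. \<bar>u \<epsilon> x\<bar> \<le> \<epsilon> ^ Suc n"
      "\<forall>\<^sub>F \<epsilon> in at_right 0. \<forall>x\<in>K. \<bar>v \<epsilon> x\<bar> \<le> \<epsilon> ^ Suc n"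
    using assms K unfolding loc_negligible_def by blast+
  then show "\<forall>\<^sub>F \<epsilon> in at_right 0. \<forall>x\<in>K. \<bar>u \<epsilon> x + v \<epsilon> x\<bar> \<le> \<epsilon> ^ n"
    using at_right_zero_less[of "1/2", simplified]
  proof eventually_elim
    case (elim \<epsilon>)
    show ?case
    proof
      fix x assume x: "x \<in> K"
      have "\<epsilon> * \<epsilon> ^ n \<le> (1 / 2) * \<epsilon> ^ n" using elim by (intro mult_right_mono) auto
      moreover have "\<bar>u \<epsilon> x\<bar> \<le> \<epsilon> * \<epsilon> ^ n" "\<bar>v \<epsilon> x\<bar> \<le> \<epsilon> * \<epsilon> ^ n"
        using elim x by auto
      ultimately show "\<bar>u \<epsilon> x + v \<epsilon> x\<bar> \<le> \<epsilon> ^ n" by linarith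
    qed
  qed
qed

lemma loc_negligible_0: "loc_negligible (\<lambda>\<epsilon> x. 0)"
  unfolding loc_negligible_def
  by (auto intro!: eventually_mono[OF at_right_zero_less[OF zero_less_one]])

text \<open>Nets are meaningful on \<open>{0<..1}\<close> only, and the filter at 0 from the right
  eventually lies in that interval.\<close>

lemma loc_negligible_cong:
  assumes "loc_negligible u" "\<And>\<epsilon> x. \<epsilon> \<in> {0<..1} \<Longrightarrow> u \<epsilon> x = v \<epsilon> x"
  shows "loc_negligible v"
  unfolding loc_negligible_def
proof (intro allI impI)
  fix K :: "'a set" and N :: nat assume "compact K"
  then have "\<forall>\<^sub>F \<epsilon> in at_right 0. \<forall>x\<in>K. \<bar>u \<epsilon> x\<bar> \<le> \<epsilon> ^ N"
    using assms(1) unfolding loc_negligible_def by blast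
  then show "\<forall>\<^sub>F \<epsilon> in at_right 0. \<forall>x\<in>K. \<bar>v \<epsilon> x\<bar> \<le> \<epsilon> ^ N"
    using at_right_zero_less[OF zero_less_one] by eventually_elim (simp add: assms(2))
qed

section \<open>Moderate and negligible nets of smooth functions\<close>

lemma partial_derivs_Nil: "partial_derivs [] f = f"
  by (simp add: partial_derivs_def)

lemma partial_derivs_Cons:
  "partial_derivs (b # bs) f = partial_deriv b (partial_derivs bs f)"
  by (simp add: partial_derivs_def)

text \<open>The last letter of a word acts first. Hence the derivatives of
  \<open>partial_deriv b f\<close> are those derivatives of \<open>f\<close> whose words end in
  \<open>b\<close>, which makes smoothness and moderateness pass to derivatives.\<close>

lemma partial_derivs_snoc:
  "partial_derivs (bs @ [b]) f = partial_derivs bs (partial_deriv b f)"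
  by (simp add: partial_derivs_def)

lemma partial_deriv_eqI:
  "((\<lambda>h. f (x + h *\<^sub>R b)) has_real_derivative d) (at 0) \<Longrightarrow> partial_deriv b f x = d"
  by (simp add: partial_deriv_def DERIV_imp_deriv)

lemma E_M_iff:
  "u \<in> E_M \<longleftrightarrow> (\<forall>\<epsilon>\<in>{0<..1}. u \<epsilon> \<in> C_infinity) \<and>
     (\<forall>bs\<in>lists Basis. loc_moderate (\<lambda>\<epsilon>. partial_derivs bs (u \<epsilon>)))"
\<comment> \<open>The suprema can be replaced by pointwise bounds only when all derivatives are
  continuous; without smoothness both sides are false.\<close>
proof (cases "\<forall>\<epsilon>\<in>{0<..1}. u \<epsilon> \<in> C_infinity")
  case True
  then have "(\<forall>K. compact K \<and> K \<noteq> {} \<longrightarrow>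
      moderate (\<lambda>\<epsilon>. SUP x\<in>K. \<bar>partial_derivs bs (u \<epsilon>) x\<bar>)) \<longleftrightarrow>
      loc_moderate (\<lambda>\<epsilon>. partial_derivs bs (u \<epsilon>))" if "bs \<in> lists Basis" for bs
    using that by (intro moderate_SUP_iff) (auto simp: C_infinity_def)
  then have "(\<forall>bs\<in>lists Basis. \<forall>K. compact K \<and> K \<noteq> {} \<longrightarrow>
      moderate (\<lambda>\<epsilon>. SUP x\<in>K. \<bar>partial_derivs bs (u \<epsilon>) x\<bar>)) \<longleftrightarrow>
      (\<forall>bs\<in>lists Basis. loc_moderate (\<lambda>\<epsilon>. partial_derivs bs (u \<epsilon>)))"
    by (intro ball_cong refl)
  moreover have "u \<in> E_M \<longleftrightarrow> (\<forall>bs\<in>lists Basis. \<forall>K. compact K \<and> K \<noteq> {} \<longrightarrow>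
      moderate (\<lambda>\<epsilon>. SUP x\<in>K. \<bar>partial_derivs bs (u \<epsilon>) x\<bar>))"
    using True unfolding E_M_def by auto
  ultimately show ?thesis using True by simp
qed (auto simp: E_M_def)

lemma N_null_iff:
  "u \<in> N_null \<longleftrightarrow> (\<forall>\<epsilon>\<in>{0<..1}. u \<epsilon> \<in> C_infinity) \<and>
     (\<forall>bs\<in>lists Basis. loc_negligible (\<lambda>\<epsilon>. partial_derivs bs (u \<epsilon>)))"
proof (cases "\<forall>\<epsilon>\<in>{0<..1}. u \<epsilon> \<in> C_infinity")
  case True
  then have "(\<forall>K. compact K \<and> K \<noteq> {} \<longrightarrow>
      negligible_net (\<lambda>\<epsilon>. SUP x\<in>K. \<bar>partial_derivs bs (u \<epsilon>) x\<bar>)) \<longleftrightarrow>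
      loc_negligible (\<lambda>\<epsilon>. partial_derivs bs (u \<epsilon>))" if "bs \<in> lists Basis" for bs
    using that by (intro negligible_SUP_iff) (auto simp: C_infinity_def)
  then have "(\<forall>bs\<in>lists Basis. \<forall>K. compact K \<and> K \<noteq> {} \<longrightarrow>
      negligible_net (\<lambda>\<epsilon>. SUP x\<in>K. \<bar>partial_derivs bs (u \<epsilon>) x\<bar>)) \<longleftrightarrow>
      (\<forall>bs\<in>lists Basis. loc_negligible (\<lambda>\<epsilon>. partial_derivs bs (u \<epsilon>)))"
    by (intro ball_cong refl)
  moreover have "u \<in> N_null \<longleftrightarrow> (\<forall>bs\<in>lists Basis. \<forall>K. compact K \<and> K \<noteq> {} \<longrightarrow>
      negligible_net (\<lambda>\<epsilon>. SUP x\<in>K. \<bar>partial_derivs bs (u \<epsilon>) x\<bar>))"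
    using True unfolding N_null_def by auto
  ultimately show ?thesis using True by simp
qed (auto simp: N_null_def)

lemma E_M_loc_moderate: "u \<in> E_M \<Longrightarrow> loc_moderate u"
  unfolding E_M_iff by (auto dest!: bspec[of _ _ "[]"] simp: partial_derivs_Nil)

lemma E_M_C_infinity: "u \<in> E_M \<Longrightarrow> \<epsilon> \<in> {0<..1} \<Longrightarrow> u \<epsilon> \<in> C_infinity"
  unfolding E_M_def by blast

lemma C_infinity_continuous: "f \<in> C_infinity \<Longrightarrow> continuous_on UNIV f"
  unfolding C_infinity_def by (auto dest!: bspec[of _ _ "[]"] simp: partial_derivs_Nil)

lemma C_infinity_has_derivative:
  assumes "f \<in> C_infinity" "b \<in> Basis"
  shows "((\<lambda>h. f (x + h *\<^sub>R b)) has_real_derivative partial_deriv b f x) (at 0)"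
proof -
  have "(\<lambda>h. partial_derivs [] f (x + h *\<^sub>R b)) field_differentiable at 0"
    using assms unfolding C_infinity_def by blast
  then show ?thesis
    by (simp add: partial_derivs_Nil partial_deriv_def DERIV_deriv_iff_field_differentiable)
qed

text \<open>\<open>C_infinity\<close> speaks about increments at 0 only; shifting the base point
  along \<open>b\<close> gives the derivative at every point of the line, as the mean value theorem
  requires.\<close>

lemma C_infinity_has_derivative_line:
  assumes "f \<in> C_infinity" "b \<in> Basis"
  shows "((\<lambda>h. f (x + h *\<^sub>R b)) has_real_derivative partial_deriv b f (x + s *\<^sub>R b)) (at s)"
proof -
  have "((\<lambda>h. f (x + (h + s) *\<^sub>R b)) has_real_derivative partial_deriv b f (x + s *\<^sub>R b)) (at 0)"
    using C_infinity_has_derivative[OF assms, of "x + s *\<^sub>R b"] by (simp add: algebra_simps)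
  then show ?thesis using DERIV_shift[of "\<lambda>h. f (x + h *\<^sub>R b)" _ 0 s] by simp
qed

lemma E_M_partial_deriv:
  assumes "u \<in> E_M" "b \<in> Basis"
  shows "(\<lambda>\<epsilon>. partial_deriv b (u \<epsilon>)) \<in> E_M"
proof -
  have "bs @ [b] \<in> lists Basis" if "bs \<in> lists Basis" for bs using that assms(2) by auto
  then show ?thesis
    using assms(1) unfolding E_M_iff C_infinity_def
    by (auto simp: partial_derivs_snoc[symmetric])
qed

text \<open>A family of continuous, locally moderate nets that is stable under differentiation
  consists of moderate nets, because every iterated derivative is again represented by a member. No
  formula for higher derivatives is needed.\<close>

lemma E_M_coinduct:
  assumes "u \<in> X"
    and cont: "\<And>v \<epsilon>. v \<in> X \<Longrightarrow> \<epsilon> \<in> {0<..1} \<Longrightarrow> continuous_on UNIV (v \<epsilon>)"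
    and moderate: "\<And>v. v \<in> X \<Longrightarrow> loc_moderate v"
    and deriv: "\<And>v b. v \<in> X \<Longrightarrow> b \<in> Basis \<Longrightarrow>
      \<exists>w\<in>X. \<forall>\<epsilon>\<in>{0<..1}. \<forall>x. ((\<lambda>h. v \<epsilon> (x + h *\<^sub>R b)) has_real_derivative w \<epsilon> x) (at 0)"
  shows "u \<in> E_M"
proof -
  have words: "\<exists>w\<in>X. \<forall>\<epsilon>\<in>{0<..1}. partial_derivs bs (u \<epsilon>) = w \<epsilon>" if "bs \<in> lists Basis" for bs
    using that
  proof (induction bs)
    case Nil
    then show ?case using assms(1) by (auto simp: partial_derivs_Nil)
  next
    case (Cons b bs)
    then obtain v where v: "v \<in> X" "\<forall>\<epsilon>\<in>{0<..1}. partial_derivs bs (u \<epsilon>) = v \<epsilon>" by blast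
    obtain w where "w \<in> X" "\<forall>\<epsilon>\<in>{0<..1}. \<forall>x.
        ((\<lambda>h. v \<epsilon> (x + h *\<^sub>R b)) has_real_derivative w \<epsilon> x) (at 0)"
      using deriv[OF v(1) Cons.hyps(1)] by blast
    then show ?case
      using v(2) by (auto simp: partial_derivs_Cons fun_eq_iff intro!: bexI[of _ w] partial_deriv_eqI)
  qed
  have "u \<epsilon> \<in> C_infinity" if e: "\<epsilon> \<in> {0<..1}" for \<epsilon>
    unfolding C_infinity_def
  proof (intro CollectI ballI conjI allI)
    fix bs :: "'a list" assume "bs \<in> lists Basis"
    from words[OF this] obtain w where w: "w \<in> X" "partial_derivs bs (u \<epsilon>) = w \<epsilon>"
      using e by blast
    then show "continuous_on UNIV (partial_derivs bs (u \<epsilon>))" using cont e by simp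
    fix b x :: 'a assume "b \<in> Basis"
    then show "(\<lambda>h. partial_derivs bs (u \<epsilon>) (x + h *\<^sub>R b)) field_differentiable at 0"
      using deriv[OF w(1), of b] e unfolding w(2) field_differentiable_def by blast
  qed
  moreover have "loc_moderate (\<lambda>\<epsilon>. partial_derivs bs (u \<epsilon>))" if bs: "bs \<in> lists Basis" for bs
  proof -
    obtain w where w: "w \<in> X" "\<forall>\<epsilon>\<in>{0<..1}. partial_derivs bs (u \<epsilon>) = w \<epsilon>"
      using words[OF bs] by blast
    show ?thesis unfolding loc_moderate_def
    proof (intro allI impI)
      fix K :: "'a set" assume "compact K"
      then obtain N :: nat where "\<forall>\<^sub>F \<epsilon> in at_right 0. \<forall>x\<in>K. \<bar>w \<epsilon> x\<bar> * \<epsilon> ^ N \<le> 1"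
        using moderate[OF w(1)] unfolding loc_moderate_def by blast
      then have "\<forall>\<^sub>F \<epsilon> in at_right 0. \<forall>x\<in>K. \<bar>partial_derivs bs (u \<epsilon>) x\<bar> * \<epsilon> ^ N \<le> 1"
        using at_right_zero_less[OF zero_less_one] by eventually_elim (use w(2) in auto)
      then show "\<exists>N. \<forall>\<^sub>F \<epsilon> in at_right 0. \<forall>x\<in>K. \<bar>partial_derivs bs (u \<epsilon>) x\<bar> * \<epsilon> ^ N \<le> 1"
        by blast
    qed
  qed
  ultimately show ?thesis unfolding E_M_iff by blast
qed

text \<open>Closing the generators under sums and products makes the Leibniz rule stay inside the
  set: once each generator has its derivatives in \<open>net_alg B\<close>, so has every
  element.\<close>

inductive_set net_alg :: "(real \<Rightarrow> 'a \<Rightarrow> real) set \<Rightarrow> (real \<Rightarrow> 'a \<Rightarrow> real) set" for B where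
  base: "u \<in> B \<Longrightarrow> u \<in> net_alg B"
| add: "u \<in> net_alg B \<Longrightarrow> v \<in> net_alg B \<Longrightarrow> (\<lambda>\<epsilon> x. u \<epsilon> x + v \<epsilon> x) \<in> net_alg B"
| mult: "u \<in> net_alg B \<Longrightarrow> v \<in> net_alg B \<Longrightarrow> (\<lambda>\<epsilon> x. u \<epsilon> x * v \<epsilon> x) \<in> net_alg B"

text \<open>Only generators have to be inspected, and their derivatives may be polynomial
  expressions in generators. This suits chain rules, which produce products.\<close>

lemma net_alg_subset_E_M:
  fixes B :: "(real \<Rightarrow> 'a::euclidean_space \<Rightarrow> real) set"
  assumes u: "u \<in> net_alg B"
    and cont: "\<And>v \<epsilon>. v \<in> B \<Longrightarrow> \<epsilon> \<in> {0<..1} \<Longrightarrow> continuous_on UNIV (v \<epsilon>)"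
    and moderate: "\<And>v. v \<in> B \<Longrightarrow> loc_moderate v"
    and deriv: "\<And>v b. v \<in> B \<Longrightarrow> b \<in> Basis \<Longrightarrow> \<exists>w\<in>net_alg B.
      \<forall>\<epsilon>\<in>{0<..1}. \<forall>x. ((\<lambda>h. v \<epsilon> (x + h *\<^sub>R b)) has_real_derivative w \<epsilon> x) (at 0)"
  shows "u \<in> E_M"
proof (rule E_M_coinduct[OF u])
  fix v assume v: "v \<in> net_alg B"
  show "continuous_on UNIV (v \<epsilon>)" if "\<epsilon> \<in> {0<..1}" for \<epsilon>
    using v by induction (use that in \<open>auto intro: continuous_on_add continuous_on_mult cont\<close>)
  show "loc_moderate v"
    using v by induction (auto intro: moderate loc_moderate_add loc_moderate_mult)
  fix b :: 'a assume b: "b \<in> Basis"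
  show "\<exists>w\<in>net_alg B.
      \<forall>\<epsilon>\<in>{0<..1}. \<forall>x. ((\<lambda>h. v \<epsilon> (x + h *\<^sub>R b)) has_real_derivative w \<epsilon> x) (at 0)"
    using v
  proof induction
    case (base u)
    then show ?case using deriv b by blast
  next
    case (add u v)
    then obtain u' v' where *: "u' \<in> net_alg B" "v' \<in> net_alg B"
      "\<forall>\<epsilon>\<in>{0<..1}. \<forall>x. ((\<lambda>h. u \<epsilon> (x + h *\<^sub>R b)) has_real_derivative u' \<epsilon> x) (at 0)"
      "\<forall>\<epsilon>\<in>{0<..1}. \<forall>x. ((\<lambda>h. v \<epsilon> (x + h *\<^sub>R b)) has_real_derivative v' \<epsilon> x) (at 0)"
      by blast
    show ?case
      by (rule bexI[OF _ net_alg.add[OF *(1,2)]]) (use *(3,4) in \<open>auto intro!: DERIV_add\<close>)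
  next
    case (mult u v)
    then obtain u' v' where *: "u' \<in> net_alg B" "v' \<in> net_alg B"
      "\<forall>\<epsilon>\<in>{0<..1}. \<forall>x. ((\<lambda>h. u \<epsilon> (x + h *\<^sub>R b)) has_real_derivative u' \<epsilon> x) (at 0)"
      "\<forall>\<epsilon>\<in>{0<..1}. \<forall>x. ((\<lambda>h. v \<epsilon> (x + h *\<^sub>R b)) has_real_derivative v' \<epsilon> x) (at 0)"
      by blast
    have "((\<lambda>h. u \<epsilon> (x + h *\<^sub>R b) * v \<epsilon> (x + h *\<^sub>R b)) has_real_derivative
        u' \<epsilon> x * v \<epsilon> x + v' \<epsilon> x * u \<epsilon> x) (at 0)" if "\<epsilon> \<in> {0<..1}" for \<epsilon> x
      using DERIV_mult[OF *(3)[rule_format, OF that, of x] *(4)[rule_format, OF that, of x]] by simp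
    then show ?case
      by (intro bexI[OF _ net_alg.add[OF net_alg.mult[OF *(1) mult.hyps(2)]
            net_alg.mult[OF *(2) mult.hyps(1)]]]) blast
  qed
qed

text \<open>Moderate nets are stable under differentiation, so they may serve as their own
  generators; closure of \<open>E_M\<close> under sums and products follows at once.\<close>

lemma net_alg_E_M: "net_alg E_M = (E_M :: (real \<Rightarrow> 'a::euclidean_space \<Rightarrow> real) set)"
proof
  show "net_alg E_M \<subseteq> (E_M :: (real \<Rightarrow> 'a \<Rightarrow> real) set)"
  proof
    fix u assume "u \<in> net_alg (E_M :: (real \<Rightarrow> 'a \<Rightarrow> real) set)"
    then show "u \<in> E_M"
    proof (rule net_alg_subset_E_M)
      fix v :: "real \<Rightarrow> 'a \<Rightarrow> real" and b :: 'a assume "v \<in> E_M" "b \<in> Basis"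
      then show "\<exists>w\<in>net_alg E_M.
          \<forall>\<epsilon>\<in>{0<..1}. \<forall>x. ((\<lambda>h. v \<epsilon> (x + h *\<^sub>R b)) has_real_derivative w \<epsilon> x) (at 0)"
        by (intro bexI[OF _ net_alg.base[OF E_M_partial_deriv]])
          (auto intro!: C_infinity_has_derivative E_M_C_infinity)
    qed (simp_all add: E_M_loc_moderate C_infinity_continuous E_M_C_infinity)
  qed
  show "E_M \<subseteq> net_alg (E_M :: (real \<Rightarrow> 'a \<Rightarrow> real) set)"
    by (blast intro: net_alg.base)
qed

lemma E_M_add: "u \<in> E_M \<Longrightarrow> v \<in> E_M \<Longrightarrow> (\<lambda>\<epsilon> x. u \<epsilon> x + v \<epsilon> x) \<in> E_M"
  using net_alg.add[of u E_M v] by (simp add: net_alg_E_M)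

lemma E_M_mult: "u \<in> E_M \<Longrightarrow> v \<in> E_M \<Longrightarrow> (\<lambda>\<epsilon> x. u \<epsilon> x * v \<epsilon> x) \<in> E_M"
  using net_alg.mult[of u E_M v] by (simp add: net_alg_E_M)

lemma E_M_const: "(\<lambda>\<epsilon> (x::'a::euclidean_space). c) \<in> E_M"
proof (rule E_M_coinduct)
  show "(\<lambda>\<epsilon> (x::'a). c) \<in> range (\<lambda>c \<epsilon> x. c)" by blast
  show "\<exists>w\<in>range (\<lambda>c \<epsilon> x. c).
      \<forall>\<epsilon>\<in>{0<..1}. \<forall>x. ((\<lambda>h. v \<epsilon> (x + h *\<^sub>R b)) has_real_derivative w \<epsilon> x) (at 0)"
    if "v \<in> range (\<lambda>c \<epsilon> x. c)" for v :: "real \<Rightarrow> 'a \<Rightarrow> real" and b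
    using that by (intro bexI[of _ "\<lambda>_ _. 0"]) auto
qed (auto simp: loc_moderate_const)

lemma E_M_uminus: "u \<in> E_M \<Longrightarrow> (\<lambda>\<epsilon> x. - u \<epsilon> x) \<in> E_M"
  using E_M_mult[OF E_M_const[of "-1"], of u] by simp

lemma E_M_diff: "u \<in> E_M \<Longrightarrow> v \<in> E_M \<Longrightarrow> (\<lambda>\<epsilon> x. u \<epsilon> x - v \<epsilon> x) \<in> E_M"
  using E_M_add[OF _ E_M_uminus, of u v] by simp

text \<open>
  Taylor's formula with a step of the size of a large power of \<open>\<epsilon>\<close> bounds a derivative by the
  function itself and its second derivative, which is moderate.
\<close>

lemma loc_negligible_partial_deriv:
  fixes u :: "real \<Rightarrow> 'a::euclidean_space \<Rightarrow> real"
  assumes u: "u \<in> E_M" and neg: "loc_negligible u" and b: "b \<in> Basis"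
  shows "loc_negligible (\<lambda>\<epsilon>. partial_deriv b (u \<epsilon>))"
  unfolding loc_negligible_def
proof (intro allI impI)
  fix K :: "'a set" and n :: nat assume K: "compact K"
  define u1 where "u1 \<epsilon> = partial_deriv b (u \<epsilon>)" for \<epsilon>
  define u2 where "u2 \<epsilon> = partial_deriv b (u1 \<epsilon>)" for \<epsilon>
  have u1: "u1 \<in> E_M" using E_M_partial_deriv[OF u b] by (simp add: u1_def[abs_def])
  have u2: "u2 \<in> E_M" using E_M_partial_deriv[OF u1 b] by (simp add: u2_def[abs_def])
  \<comment> \<open>Intermediate points of the mean value theorem leave \<open>K\<close>;
    \<open>K'\<close> contains all of them for steps up to length 1, independently of
    \<epsilon>.\<close>
  define K' where "K' = (\<lambda>(x, s). x + s *\<^sub>R b) ` (K \<times> {0..1::real})"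
  have K': "compact K'" unfolding K'_def case_prod_unfold
    by (intro compact_continuous_image compact_Times K continuous_intros) auto
  obtain M :: nat where M: "\<forall>\<^sub>F \<epsilon> in at_right 0. \<forall>x\<in>K'. \<bar>u2 \<epsilon> x\<bar> * \<epsilon> ^ M \<le> 1"
    using E_M_loc_moderate[OF u2] K' unfolding loc_moderate_def by blast
  have "\<forall>\<^sub>F \<epsilon> in at_right 0. \<forall>x\<in>K'. \<bar>u \<epsilon> x\<bar> \<le> \<epsilon> ^ ((M + n + 1) + (n + 1))"
    using neg K' unfolding loc_negligible_def by blast
  then show "\<forall>\<^sub>F \<epsilon> in at_right 0. \<forall>x\<in>K. \<bar>partial_deriv b (u \<epsilon>) x\<bar> \<le> \<epsilon> ^ n"
    \<comment> \<open>The final bound is \<open>3 * \<epsilon> ^ (n + 1)\<close>: two terms from the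
      difference quotient, one from the second derivative.\<close>
    using M at_right_zero_less[of "1/3", simplified]
  proof eventually_elim
    case (elim \<epsilon>)
    then have e: "0 < \<epsilon>" "\<epsilon> < 1/3" "\<epsilon> \<in> {0<..1}" by auto
    \<comment> \<open>With this step, the second derivative, of size at most
      \<open>1 / \<epsilon> ^ M\<close>, contributes at most \<open>\<epsilon> ^ (n + 1)\<close>;
      and the bound required of \<open>u\<close> is \<open>h * \<epsilon> ^ (n + 1)\<close>, so
      \<open>\<epsilon> ^ (n + 1)\<close> survives division by \<open>h\<close>.\<close>
    define h where "h = \<epsilon> ^ (M + n + 1)"
    have h: "0 < h" "h \<le> 1" unfolding h_def using e by (auto simp del: power_Suc power_add intro!: power_le_one)
    show ?case
    proof
      fix x assume x: "x \<in> K"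
      have inK': "x + s *\<^sub>R b \<in> K'" if "0 \<le> s" "s \<le> h" for s
        using x that h unfolding K'_def by force
      obtain z where z: "0 < z" "z < h"
          "u \<epsilon> (x + h *\<^sub>R b) - u \<epsilon> (x + 0 *\<^sub>R b) = (h - 0) * u1 \<epsilon> (x + z *\<^sub>R b)"
        using MVT2[OF h(1), of "\<lambda>s. u \<epsilon> (x + s *\<^sub>R b)" "\<lambda>s. u1 \<epsilon> (x + s *\<^sub>R b)"]
          C_infinity_has_derivative_line[OF E_M_C_infinity[OF u e(3)] b] u1_def by auto
      \<comment> \<open>A second mean value compares the derivative at the intermediate point
        \<open>z\<close> with the derivative at \<open>x\<close> itself.\<close>
      obtain y where y: "0 < y" "y < z"
          "u1 \<epsilon> (x + z *\<^sub>R b) - u1 \<epsilon> (x + 0 *\<^sub>R b) = (z - 0) * u2 \<epsilon> (x + y *\<^sub>R b)"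
        using MVT2[OF z(1), of "\<lambda>s. u1 \<epsilon> (x + s *\<^sub>R b)" "\<lambda>s. u2 \<epsilon> (x + s *\<^sub>R b)"]
          C_infinity_has_derivative_line[OF E_M_C_infinity[OF u1 e(3)] b] u2_def by auto
      have "h * \<bar>u1 \<epsilon> (x + z *\<^sub>R b)\<bar> = \<bar>u \<epsilon> (x + h *\<^sub>R b) - u \<epsilon> x\<bar>"
        using z h by (simp add: abs_mult)
      also have "\<dots> \<le> \<bar>u \<epsilon> (x + h *\<^sub>R b)\<bar> + \<bar>u \<epsilon> x\<bar>" by simp
      also have "\<dots> \<le> h * \<epsilon> ^ (n + 1) + h * \<epsilon> ^ (n + 1)"
        using elim(1) inK'[of h] inK'[of 0] h unfolding power_add[of _ "M + n + 1"] h_def[symmetric]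
        by (intro add_mono) auto
      finally have 1: "\<bar>u1 \<epsilon> (x + z *\<^sub>R b)\<bar> \<le> 2 * \<epsilon> ^ (n + 1)" using h(1) by simp
      have "z * \<bar>u2 \<epsilon> (x + y *\<^sub>R b)\<bar> \<le> h * \<bar>u2 \<epsilon> (x + y *\<^sub>R b)\<bar>"
        using z by (intro mult_right_mono) auto
      also have "\<dots> = \<epsilon> ^ (n + 1) * (\<bar>u2 \<epsilon> (x + y *\<^sub>R b)\<bar> * \<epsilon> ^ M)"
        by (simp add: h_def power_add)
      also have "\<dots> \<le> \<epsilon> ^ (n + 1) * 1"
        using e elim(2) inK'[of y] y z by (intro mult_left_mono) auto
      finally have "\<bar>u1 \<epsilon> (x + z *\<^sub>R b) - u1 \<epsilon> x\<bar> \<le> \<epsilon> ^ (n + 1)"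
        using y z by (simp add: abs_mult)
      with 1 have "\<bar>u1 \<epsilon> x\<bar> \<le> 3 * \<epsilon> * \<epsilon> ^ n" by simp
      also have "\<dots> \<le> 1 * \<epsilon> ^ n" using e by (intro mult_right_mono) auto
      finally show "\<bar>partial_deriv b (u \<epsilon>) x\<bar> \<le> \<epsilon> ^ n" by (simp add: u1_def)
    qed
  qed
qed

lemma N_null_eq:
  "N_null = {u :: real \<Rightarrow> 'a::euclidean_space \<Rightarrow> real. u \<in> E_M \<and> loc_negligible u}"
proof (intro set_eqI iffI CollectI conjI)
  fix u :: "real \<Rightarrow> 'a \<Rightarrow> real" assume u: "u \<in> N_null"
  then show "u \<in> E_M" unfolding N_null_iff E_M_iff by (blast intro: loc_negligible_imp_moderate)
  show "loc_negligible u"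
    using u unfolding N_null_iff by (auto dest!: bspec[of _ _ "[]"] simp: partial_derivs_Nil)
next
  fix u :: "real \<Rightarrow> 'a \<Rightarrow> real" assume "u \<in> {u. u \<in> E_M \<and> loc_negligible u}"
  then have u: "u \<in> E_M" "loc_negligible u" by auto
  \<comment> \<open>Moderateness travels along the induction, since passing to one more derivative
    presupposes it for the net already differentiated.\<close>
  have "(\<lambda>\<epsilon>. partial_derivs bs (u \<epsilon>)) \<in> E_M \<and> loc_negligible (\<lambda>\<epsilon>. partial_derivs bs (u \<epsilon>))"
    if "bs \<in> lists Basis" for bs
    using that
  proof (induction bs)
    case (Cons b bs)
    then show ?case unfolding partial_derivs_Cons
      using loc_negligible_partial_deriv[of "\<lambda>\<epsilon>. partial_derivs bs (u \<epsilon>)" b] E_M_partial_deriv by blast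
  qed (use u in \<open>simp add: partial_derivs_Nil\<close>)
  then show "u \<in> N_null" unfolding N_null_iff using E_M_C_infinity[OF u(1)] by blast
qed

section \<open>Transport along characteristics\<close>

lemma Basis_real_prod: "(1, 0) \<in> (Basis :: (real \<times> real) set)" "(0, 1) \<in> (Basis :: (real \<times> real) set)"
  by (auto simp: Basis_prod_def)

lemma C_infinity_partial_deriv:
  assumes "f \<in> C_infinity" "b \<in> Basis"
  shows "partial_deriv b f \<in> C_infinity"
proof -
  have "bs @ [b] \<in> lists Basis" if "bs \<in> lists Basis" for bs using that assms(2) by auto
  then show ?thesis
    using assms(1) unfolding C_infinity_def by (auto simp: partial_derivs_snoc[symmetric])
qed

lemma C_infinity_DERIV_real:
  "f \<in> C_infinity \<Longrightarrow> (f has_real_derivative partial_deriv 1 f x) (at x)"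
  using C_infinity_has_derivative_line[of f 1 0 x] by simp

text \<open>Smoothness is defined through partial derivatives; continuity of one of them upgrades
  the pair to a total derivative, which the chain rule along a curve in the plane requires.\<close>

lemma C_infinity_has_derivative_real_prod:
  fixes f :: "real \<times> real \<Rightarrow> real"
  assumes f: "f \<in> C_infinity"
  shows "(f has_derivative
    (\<lambda>(a, b). a * partial_deriv (1, 0) f p + b * partial_deriv (0, 1) f p)) (at p)"
proof -
  obtain x t where p: "p = (x, t)" by (cases p)
  note B = Basis_real_prod
  have fx: "((\<lambda>x. f (x, t)) has_derivative (\<lambda>a. a * partial_deriv (1, 0) f (x, t))) (at x within UNIV)"
    using C_infinity_has_derivative_line[OF f B(1), of "(0, t)" x]
    by (simp add: has_field_derivative_def mult_commute_abs)
  have fy: "((\<lambda>t. f (x, t)) has_derivative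
      blinfun_apply (blinfun_scaleR_left (partial_deriv (0, 1) f (x, t)))) (at t within UNIV)" for x t
    using C_infinity_has_derivative_line[OF f B(2), of "(x, 0)" t]
    by (simp add: has_field_derivative_def mult_commute_abs)
  have "continuous_on UNIV (partial_deriv (0, 1) f)"
    by (intro C_infinity_continuous C_infinity_partial_deriv f B)
  then have "isCont (\<lambda>p. blinfun_scaleR_left (partial_deriv (0, 1) f p)) (x, t)"
    by (intro bounded_linear.isCont[OF bounded_linear_blinfun_scaleR_left])
      (simp add: continuous_on_eq_continuous_at)
  then have "continuous (at (x, t) within UNIV \<times> UNIV)
      (\<lambda>(x, t). blinfun_scaleR_left (partial_deriv (0, 1) f (x, t)))"
    by (simp add: case_prod_unfold)
  from has_derivative_partialsI[OF fx fy this] show ?thesis by (simp add: p)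
qed

text \<open>The compact set \<open>K'\<close> must serve all \<epsilon> at once, because the
  exponent of a moderate bound may depend on the compact set.\<close>

lemma loc_moderate_compose:
  fixes \<phi> :: "real \<Rightarrow> 'b::euclidean_space \<Rightarrow> 'a::euclidean_space"
  assumes "loc_moderate v"
    and "\<And>K. compact K \<Longrightarrow> \<exists>K'. compact K' \<and> (\<forall>\<epsilon>\<in>{0<..1}. \<phi> \<epsilon> ` K \<subseteq> K')"
  shows "loc_moderate (\<lambda>\<epsilon> p. v \<epsilon> (\<phi> \<epsilon> p))"
  unfolding loc_moderate_def
proof (intro allI impI)
  fix K :: "'b set" assume "compact K"
  from assms(2)[OF this] obtain K' where K': "compact K'" "\<forall>\<epsilon>\<in>{0<..1}. \<phi> \<epsilon> ` K \<subseteq> K'" by blast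
  then obtain N :: nat where "\<forall>\<^sub>F \<epsilon> in at_right 0. \<forall>x\<in>K'. \<bar>v \<epsilon> x\<bar> * \<epsilon> ^ N \<le> 1"
    using assms(1) unfolding loc_moderate_def by blast
  then have "\<forall>\<^sub>F \<epsilon> in at_right 0. \<forall>x\<in>K. \<bar>v \<epsilon> (\<phi> \<epsilon> x)\<bar> * \<epsilon> ^ N \<le> 1"
    using at_right_zero_less[OF zero_less_one]
  proof eventually_elim
    case (elim \<epsilon>)
    then have "\<phi> \<epsilon> ` K \<subseteq> K'" using K'(2) by simp
    with elim show ?case by blast
  qed
  then show "\<exists>N. \<forall>\<^sub>F \<epsilon> in at_right 0. \<forall>x\<in>K. \<bar>v \<epsilon> (\<phi> \<epsilon> x)\<bar> * \<epsilon> ^ N \<le> 1" by blast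
qed

text \<open>The deterministic situation on a single path. The speed \<open>l\<close> may blow up
  like a power of \<open>1/\<epsilon>\<close>, whereas \<open>L\<close> is bounded on bounded time
  intervals uniformly in \<epsilon>.\<close>

locale characteristics =
  fixes l L :: "real \<Rightarrow> real \<Rightarrow> real"
  assumes l: "l \<in> E_M"
    and L0: "\<And>\<epsilon>. \<epsilon> \<in> {0<..1} \<Longrightarrow> L \<epsilon> 0 = 0"
    and L_deriv: "\<And>\<epsilon> t. \<epsilon> \<in> {0<..1} \<Longrightarrow> (L \<epsilon> has_real_derivative l \<epsilon> t) (at t)"
    and L_bounded: "\<And>T. \<exists>C. \<forall>\<epsilon>\<in>{0<..1}. \<forall>t. \<bar>t\<bar> \<le> T \<longrightarrow> \<bar>L \<epsilon> t\<bar> \<le> C"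
begin

lemma L_continuous: "\<epsilon> \<in> {0<..1} \<Longrightarrow> continuous_on S (L \<epsilon>)"
  by (meson DERIV_isCont L_deriv continuous_at_imp_continuous_on)

text \<open>The argument of \<open>v\<close> is the foot, at time 0, of the characteristic through
  \<open>p\<close>.\<close>

definition transported :: "(real \<Rightarrow> real \<Rightarrow> real) \<Rightarrow> real \<Rightarrow> real \<times> real \<Rightarrow> real" where
  "transported v \<epsilon> p = v \<epsilon> (fst p - L \<epsilon> (snd p))"

lemma transported_DERIV_x:
  assumes "v \<in> E_M" "\<epsilon> \<in> {0<..1}"
  shows "((\<lambda>h. transported v \<epsilon> (p + h *\<^sub>R (1, 0))) has_real_derivative
    transported (\<lambda>\<epsilon>. partial_deriv 1 (v \<epsilon>)) \<epsilon> p) (at 0)"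
proof -
  \<comment> \<open>The point is written with \<open>+ 0\<close> so that it is literally the inner
    function at \<open>h = 0\<close>, as the chain rule expects.\<close>
  have "(v \<epsilon> has_real_derivative partial_deriv 1 (v \<epsilon>) (fst p - L \<epsilon> (snd p)))
      (at (fst p + 0 - L \<epsilon> (snd p)))"
    using C_infinity_DERIV_real[OF E_M_C_infinity[OF assms]] by simp
  moreover have "((\<lambda>h. fst p + h - L \<epsilon> (snd p)) has_real_derivative 1) (at 0)"
    by (auto intro!: derivative_eq_intros)
  ultimately show ?thesis unfolding transported_def using DERIV_chain2 by fastforce
qed

lemma transported_DERIV_t:
  assumes "v \<in> E_M" "\<epsilon> \<in> {0<..1}"
  shows "((\<lambda>h. transported v \<epsilon> (p + h *\<^sub>R (0, 1))) has_real_derivative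
    - l \<epsilon> (snd p) * transported (\<lambda>\<epsilon>. partial_deriv 1 (v \<epsilon>)) \<epsilon> p) (at 0)"
proof -
  have "(v \<epsilon> has_real_derivative partial_deriv 1 (v \<epsilon>) (fst p - L \<epsilon> (snd p)))
      (at (fst p - L \<epsilon> (snd p + 0)))"
    using C_infinity_DERIV_real[OF E_M_C_infinity[OF assms]] by simp
  moreover have "((\<lambda>h. L \<epsilon> (snd p + h)) has_real_derivative l \<epsilon> (snd p)) (at 0)"
    using L_deriv[OF assms(2), of "snd p"] DERIV_shift[of "L \<epsilon>" "l \<epsilon> (snd p)" 0 "snd p"]
    by (simp add: add.commute)
  then have "((\<lambda>h. fst p - L \<epsilon> (snd p + h)) has_real_derivative - l \<epsilon> (snd p)) (at 0)"
    by (auto intro!: derivative_eq_intros)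
  ultimately show ?thesis unfolding transported_def using DERIV_chain2 by (fastforce simp: mult.commute)
qed

text \<open>The two kinds of nets are treated together as generators: an \<open>x\<close>-derivative
  of a transported net is transported, a \<open>t\<close>-derivative is a time net times a
  transported one, and time nets have time nets as derivatives.\<close>

lemma transported_E_M_and_time_E_M:
  assumes "v \<in> E_M"
  shows "transported v \<in> E_M" "(\<lambda>\<epsilon> p. v \<epsilon> (snd (p :: real \<times> real))) \<in> E_M"
proof -
  define B where "B = transported ` E_M \<union> (\<lambda>v \<epsilon> p. v \<epsilon> (snd (p :: real \<times> real))) ` E_M"
  have sub: "u \<in> E_M" if "u \<in> net_alg B" for u
    using that
  proof (rule net_alg_subset_E_M)
    fix w \<epsilon> assume w: "w \<in> B" and e: "\<epsilon> \<in> {0<..1::real}"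
    have *: "continuous_on UNIV (v \<epsilon>)" if "v \<in> E_M" for v :: "real \<Rightarrow> real \<Rightarrow> real"
      using C_infinity_continuous[OF E_M_C_infinity[OF that e]] .
    have L: "continuous_on UNIV (\<lambda>p :: real \<times> real. L \<epsilon> (snd p))"
      by (rule continuous_on_compose2[OF L_continuous[OF e, of UNIV] continuous_on_snd])
        (auto intro: continuous_on_id)
    have "continuous_on UNIV (\<lambda>p. v \<epsilon> (fst p - L \<epsilon> (snd p)))"
        "continuous_on UNIV (\<lambda>p :: real \<times> real. v \<epsilon> (snd p))" if "v \<in> E_M" for v
      using continuous_on_compose2[OF *[OF that] continuous_on_diff[OF continuous_on_fst[OF continuous_on_id] L]]
        continuous_on_compose2[OF *[OF that] continuous_on_snd[OF continuous_on_id]] by auto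
    then show "continuous_on UNIV (w \<epsilon>)"
      using w unfolding B_def transported_def[abs_def] by blast
  next
    fix w assume w: "w \<in> B"
    then obtain v where v: "v \<in> E_M" "w = transported v \<or> w = (\<lambda>\<epsilon> p. v \<epsilon> (snd p))"
      unfolding B_def by blast
    have 1: "\<exists>K'. compact K' \<and> (\<forall>\<epsilon>\<in>{0<..1::real}. snd ` K \<subseteq> K')"
      if "compact K" for K :: "(real \<times> real) set"
      using that by (intro exI[of _ "snd ` K"]) (auto intro!: compact_continuous_image continuous_intros)
    \<comment> \<open>This is where the uniform bound on \<open>L\<close> enters: the foot moves by
      at most \<open>C\<close>, so it stays in one ball for all \<epsilon>.\<close>
    have 2: "\<exists>K'. compact K' \<and> (\<forall>\<epsilon>\<in>{0<..1}. (\<lambda>p. fst p - L \<epsilon> (snd p)) ` K \<subseteq> K')"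
      if K: "compact K" for K :: "(real \<times> real) set"
    proof -
      obtain R where R: "\<And>p. p \<in> K \<Longrightarrow> norm p \<le> R"
        using compact_imp_bounded[OF K] unfolding bounded_iff by blast
      obtain C where C: "\<forall>\<epsilon>\<in>{0<..1}. \<forall>t. \<bar>t\<bar> \<le> R \<longrightarrow> \<bar>L \<epsilon> t\<bar> \<le> C" using L_bounded by blast
      have "\<bar>fst p - L \<epsilon> (snd p)\<bar> \<le> R + C" if "p \<in> K" "\<epsilon> \<in> {0<..1}" for p \<epsilon>
      proof -
        have "\<bar>fst p\<bar> \<le> R" "\<bar>snd p\<bar> \<le> R"
          using R[OF that(1)] norm_fst_le[of "fst p" "snd p"] norm_snd_le[of "snd p" "fst p"] by auto
        moreover from this have "\<bar>L \<epsilon> (snd p)\<bar> \<le> C" using C that(2) by blast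
        ultimately show ?thesis by linarith
      qed
      then show ?thesis by (intro exI[of _ "cball 0 (R + C)"]) auto
    qed
    show "loc_moderate w"
      using v loc_moderate_compose[OF E_M_loc_moderate[OF v(1)] 1]
        loc_moderate_compose[OF E_M_loc_moderate[OF v(1)] 2] by (auto simp: transported_def[abs_def])
    fix b :: "real \<times> real" assume "b \<in> Basis"
    then have b: "b = (1, 0) \<or> b = (0, 1)" by (auto simp: Basis_prod_def)
    have v': "(\<lambda>\<epsilon>. partial_deriv 1 (v \<epsilon>)) \<in> E_M" by (rule E_M_partial_deriv[OF v(1)]) simp
    have time: "((\<lambda>h. v \<epsilon> (snd (p + h *\<^sub>R (1, 0)))) has_real_derivative 0) (at 0)"
      "((\<lambda>h. v \<epsilon> (snd (p + h *\<^sub>R (0, 1)))) has_real_derivative partial_deriv 1 (v \<epsilon>) (snd p)) (at 0)"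
      if "\<epsilon> \<in> {0<..1}" for \<epsilon> and p :: "real \<times> real"
      using C_infinity_has_derivative[OF E_M_C_infinity[OF v(1) that], of 1 "snd p"] by simp_all
    have B: "transported u \<in> net_alg B" "(\<lambda>\<epsilon> p. u \<epsilon> (snd p)) \<in> net_alg B" if "u \<in> E_M" for u
      using that by (auto simp: B_def intro!: net_alg.base)
    note mB = net_alg.mult[OF B(2)[OF E_M_uminus[OF l]] B(1)[OF v']]
    show "\<exists>w'\<in>net_alg B. \<forall>\<epsilon>\<in>{0<..1}. \<forall>x.
        ((\<lambda>h. w \<epsilon> (x + h *\<^sub>R b)) has_real_derivative w' \<epsilon> x) (at 0)"
      using v(2) b
    proof (elim disjE)
      assume "w = transported v" "b = (1, 0)"
      then show ?thesis using transported_DERIV_x[OF v(1)] by (intro bexI[OF _ B(1)[OF v']]) blast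
    next
      assume "w = transported v" "b = (0, 1)"
      then show ?thesis using transported_DERIV_t[OF v(1)] by (intro bexI[OF _ mB]) blast
    next
      assume "w = (\<lambda>\<epsilon> p. v \<epsilon> (snd p))" "b = (1, 0)"
      then show ?thesis using time(1) by (intro bexI[OF _ B(2)[OF E_M_const[of 0]]]) blast
    next
      assume "w = (\<lambda>\<epsilon> p. v \<epsilon> (snd p))" "b = (0, 1)"
      then show ?thesis using time(2) by (intro bexI[OF _ B(2)[OF v']]) blast
    qed
  qed
  show "transported v \<in> E_M" "(\<lambda>\<epsilon> p. v \<epsilon> (snd (p :: real \<times> real))) \<in> E_M"
    by (rule sub[OF net_alg.base], use assms in \<open>auto simp: B_def\<close>)+
qed

lemma transported_solves:
  assumes "v \<in> E_M" "\<epsilon> \<in> {0<..1}"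
  shows "partial_deriv (0, 1) (transported v \<epsilon>) p +
    l \<epsilon> (snd p) * partial_deriv (1, 0) (transported v \<epsilon>) p = 0"
  using partial_deriv_eqI[OF transported_DERIV_x[OF assms, of p]]
    partial_deriv_eqI[OF transported_DERIV_t[OF assms, of p]] by simp

text \<open>Integrate along the characteristic through \<open>(x, t)\<close>, on which \<open>d\<close> varies at the rate given
  by the (negligible) left-hand side of the equation.\<close>

lemma negligible_of_negligible_data:
  fixes d :: "real \<Rightarrow> real \<times> real \<Rightarrow> real"
  assumes d: "d \<in> E_M"
    and eq: "loc_negligible (\<lambda>\<epsilon> p. partial_deriv (0, 1) (d \<epsilon>) p + l \<epsilon> (snd p) * partial_deriv (1, 0) (d \<epsilon>) p)"
    and init: "loc_negligible (\<lambda>\<epsilon> x. d \<epsilon> (x, 0))"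
  shows "loc_negligible d"
  unfolding loc_negligible_def
proof (intro allI impI)
  fix K :: "(real \<times> real) set" and n :: nat assume "compact K"
  then obtain R where R: "R > 0" "\<And>p. p \<in> K \<Longrightarrow> norm p \<le> R"
    using compact_imp_bounded[of K] unfolding bounded_pos by blast
  obtain C where C: "\<forall>\<epsilon>\<in>{0<..1}. \<forall>t. \<bar>t\<bar> \<le> R \<longrightarrow> \<bar>L \<epsilon> t\<bar> \<le> C" using L_bounded by blast
  \<comment> \<open>The first coordinate \<open>x - L \<epsilon> t + L \<epsilon> s\<close> of a
    characteristic consists of \<open>x\<close>, at most \<open>R\<close>, and two values of
    \<open>L\<close>, at most \<open>C\<close> each.\<close>
  define K1 where "K1 = cball (0::real) (R + 2 * C)"
  define K2 where "K2 = K1 \<times> cball (0::real) R"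
  define r where "r \<epsilon> p = partial_deriv (0, 1) (d \<epsilon>) p + l \<epsilon> (snd p) * partial_deriv (1, 0) (d \<epsilon>) p"
    for \<epsilon> p
  have "compact K1" "compact K2" unfolding K2_def K1_def by (auto intro: compact_Times)
  then have "\<forall>\<^sub>F \<epsilon> in at_right 0. \<forall>x\<in>K1. \<bar>d \<epsilon> (x, 0)\<bar> \<le> \<epsilon> ^ Suc n"
      "\<forall>\<^sub>F \<epsilon> in at_right 0. \<forall>p\<in>K2. \<bar>r \<epsilon> p\<bar> \<le> \<epsilon> ^ Suc n"
    using init eq unfolding loc_negligible_def r_def by blast+
  then show "\<forall>\<^sub>F \<epsilon> in at_right 0. \<forall>p\<in>K. \<bar>d \<epsilon> p\<bar> \<le> \<epsilon> ^ n"
    using at_right_zero_less[OF zero_less_one]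
      at_right_zero_less[of "1 / (1 + R)", OF divide_pos_pos[OF zero_less_one add_pos_pos[OF zero_less_one R(1)]]]
  proof eventually_elim
    case (elim \<epsilon>)
    then have e: "\<epsilon> \<in> {0<..1}" "0 < \<epsilon>" by auto
    have "(1 + R) * \<epsilon> < 1" using elim R(1) by (simp add: pos_less_divide_eq mult.commute)
    \<comment> \<open>The threshold \<open>1 / (1 + R)\<close> lets the spare factor \<epsilon>
      absorb \<open>1 + R\<close>: 1 for the initial value and \<open>R\<close> for the length of
      the time interval.\<close>
    then have eR: "\<epsilon> ^ Suc n * (1 + R) \<le> \<epsilon> ^ n"
      using e(2) mult_left_mono[of "(1 + R) * \<epsilon>" 1 "\<epsilon> ^ n"] by (simp add: mult_ac)
    show ?case
    proof
      fix p assume p: "p \<in> K"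
      obtain x t where xt: "p = (x, t)" by (cases p)
      have x: "\<bar>x\<bar> \<le> R" "\<bar>t\<bar> \<le> R"
        using R(2)[OF p] norm_fst_le[of x t] norm_snd_le[of t x] by (auto simp: xt)
      \<comment> \<open>Normalised to pass through \<open>p\<close> at time \<open>t\<close>;
        \<open>\<gamma> 0\<close> lies on the initial line.\<close>
      define \<gamma> where "\<gamma> s = (x - L \<epsilon> t + L \<epsilon> s, s)" for s
      have \<gamma>K: "fst (\<gamma> s) \<in> K1" "\<gamma> s \<in> K2" if "\<bar>s\<bar> \<le> R" for s
      proof -
        have "\<bar>L \<epsilon> s\<bar> \<le> C" "\<bar>L \<epsilon> t\<bar> \<le> C" using C e(1) that x by blast+
        then show "fst (\<gamma> s) \<in> K1" "\<gamma> s \<in> K2" using x that by (auto simp: \<gamma>_def K1_def K2_def)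
      qed
      have "((\<lambda>s. d \<epsilon> (\<gamma> s)) has_real_derivative r \<epsilon> (\<gamma> s)) (at s)" for s
      proof -
        have "((\<lambda>s. x - L \<epsilon> t + L \<epsilon> s) has_derivative (\<lambda>h. h * l \<epsilon> s)) (at s)"
          using L_deriv[OF e(1), of s]
          by (auto simp: has_field_derivative_def mult.commute intro!: derivative_eq_intros)
        then have "(\<gamma> has_derivative (\<lambda>h. (h * l \<epsilon> s, h))) (at s)"
          unfolding \<gamma>_def by (intro has_derivative_Pair has_derivative_ident)
        from has_derivative_compose[OF this
            C_infinity_has_derivative_real_prod[OF E_M_C_infinity[OF d e(1)]]]
        moreover have "(*) (r \<epsilon> (\<gamma> s)) = (\<lambda>h. h * l \<epsilon> s * partial_deriv (1, 0) (d \<epsilon>) (\<gamma> s) +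
            h * partial_deriv (0, 1) (d \<epsilon>) (\<gamma> s))"
          by (auto simp: fun_eq_iff r_def \<gamma>_def algebra_simps)
        ultimately show ?thesis by (simp add: has_field_derivative_def)
      qed
      \<comment> \<open>Mean value inequality on the interval \<open>cball 0 R\<close>, which
        contains both 0 and \<open>t\<close> whatever the sign of \<open>t\<close>.\<close>
      then have "norm (d \<epsilon> (\<gamma> t) - d \<epsilon> (\<gamma> 0)) \<le> \<epsilon> ^ Suc n * norm (t - 0)"
        using elim(2) \<gamma>K x(2) R(1)
        by (intro field_differentiable_bound[of "cball 0 R" _ "\<lambda>s. r \<epsilon> (\<gamma> s)"])
          (auto intro: has_field_derivative_at_within)
      moreover have "\<bar>d \<epsilon> (\<gamma> 0)\<bar> \<le> \<epsilon> ^ Suc n"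
        using elim(1) \<gamma>K(1)[of 0] R(1) by (auto simp: \<gamma>_def)
      moreover have "\<gamma> t = p" by (simp add: \<gamma>_def xt)
      ultimately have "\<bar>d \<epsilon> p\<bar> \<le> \<epsilon> ^ Suc n + \<epsilon> ^ Suc n * \<bar>t\<bar>" by simp
      also have "\<dots> = \<epsilon> ^ Suc n * (1 + \<bar>t\<bar>)" by (simp add: algebra_simps)
      also have "\<dots> \<le> \<epsilon> ^ Suc n * (1 + R)"
        using x e(2) by (intro mult_left_mono) auto
      finally show "\<bar>d \<epsilon> p\<bar> \<le> \<epsilon> ^ n" using eR by linarith
    qed
  qed
qed

end

text \<open>The claim about time nets does not mention \<open>L\<close>, so it can be read off from
  the instance with zero speed.\<close>

lemma time_E_M: "v \<in> E_M \<Longrightarrow> (\<lambda>\<epsilon> p. v \<epsilon> (snd (p :: real \<times> real))) \<in> E_M"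
proof -
  interpret characteristics "\<lambda>_ _. 0" "\<lambda>_ _. 0" by unfold_locales (auto simp: E_M_const)
  show "v \<in> E_M \<Longrightarrow> (\<lambda>\<epsilon> p. v \<epsilon> (snd (p :: real \<times> real))) \<in> E_M"
    by (rule transported_E_M_and_time_E_M)
qed

text \<open>Restrictions of moderate nets to the line \<open>t = 0\<close> form a family stable
  under differentiation: the derivative of a restriction is the restriction of the
  \<open>x\<close>-derivative.\<close>

lemma time_zero_E_M:
  fixes u :: "real \<Rightarrow> real \<times> real \<Rightarrow> real"
  assumes "u \<in> E_M"
  shows "(\<lambda>\<epsilon> x. u \<epsilon> (x, 0)) \<in> E_M"
proof (rule E_M_coinduct)
  define X where "X = (\<lambda>(u :: real \<Rightarrow> real \<times> real \<Rightarrow> real) \<epsilon> x. u \<epsilon> (x, 0)) ` E_M"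
  show "(\<lambda>\<epsilon> x. u \<epsilon> (x, 0)) \<in> X" using assms by (simp add: X_def)
  fix w assume "w \<in> X"
  then obtain v :: "real \<Rightarrow> real \<times> real \<Rightarrow> real" where v: "v \<in> E_M" "w = (\<lambda>\<epsilon> x. v \<epsilon> (x, 0))"
    by (auto simp: X_def)
  show "continuous_on UNIV (w \<epsilon>)" if "\<epsilon> \<in> {0<..1}" for \<epsilon>
    unfolding v(2) using C_infinity_continuous[OF E_M_C_infinity[OF v(1) that]]
    by (rule continuous_on_compose2) (auto intro!: continuous_intros)
  have "\<exists>K'. compact K' \<and> (\<forall>\<epsilon>\<in>{0<..1::real}. (\<lambda>x. (x, 0::real)) ` K \<subseteq> K')"
    if "compact K" for K :: "real set"
    using that by (intro exI[of _ "K \<times> {0}"]) (auto intro!: compact_Times)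
  from loc_moderate_compose[OF E_M_loc_moderate[OF v(1)] this] show "loc_moderate w"
    by (simp add: v(2))
  fix b :: real assume b: "b \<in> Basis"
  note B = Basis_real_prod(1)
  have "(\<lambda>\<epsilon> x. partial_deriv (1, 0) (v \<epsilon>) (x, 0)) \<in> X"
    using E_M_partial_deriv[OF v(1) B] by (auto simp: X_def)
  moreover have "((\<lambda>h. w \<epsilon> (x + h *\<^sub>R b)) has_real_derivative
      partial_deriv (1, 0) (v \<epsilon>) (x, 0)) (at 0)" if "\<epsilon> \<in> {0<..1}" for \<epsilon> x
    using C_infinity_has_derivative[OF E_M_C_infinity[OF v(1) that] B, of "(x, 0)"] b
    by (simp add: v(2))
  ultimately show "\<exists>w'\<in>X. \<forall>\<epsilon>\<in>{0<..1}. \<forall>x.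
      ((\<lambda>h. w \<epsilon> (x + h *\<^sub>R b)) has_real_derivative w' \<epsilon> x) (at 0)"
    by (intro bexI[of _ "\<lambda>\<epsilon> x. partial_deriv (1, 0) (v \<epsilon>) (x, 0)"]) auto
qed

section \<open>Generalized random fields\<close>

text \<open>Corresponding preimages differ by a subset of a null set, which is measurable by
  completeness. This transfers measurability from versions defined by limits to the actual
  fields.\<close>

lemma (in complete_measure) borel_measurable_AE_eq:
  assumes f: "f \<in> borel_measurable M" and eq: "AE x in M. f x = g x"
  shows "g \<in> borel_measurable M"
proof (rule measurableI)
  fix A :: "'b set" assume "A \<in> sets borel"
  with f have "f -` A \<inter> space M \<in> sets M" by (rule measurable_sets)
  moreover have "AE x in M. x \<in> f -` A \<inter> space M \<longleftrightarrow> x \<in> g -` A \<inter> space M"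
    using eq by eventually_elim auto
  ultimately show "g -` A \<inter> space M \<in> sets M" by (metis in_sets_AE Int_lower2)
qed auto

text \<open>Rounding down to the grid of mesh \<open>1 / Suc n\<close> errs by at most the mesh;
  \<open>Suc\<close> keeps the denominator nonzero.\<close>

lemma LIMSEQ_floor_mult_div:
  fixes x :: real
  shows "(\<lambda>n. of_int \<lfloor>of_nat (Suc n) * x\<rfloor> / of_nat (Suc n)) \<longlonglongrightarrow> x"
proof (rule tendsto_sandwich)
  show "(\<lambda>n. x - 1 / of_nat (Suc n)) \<longlonglongrightarrow> x"
    using tendsto_diff[OF tendsto_const LIMSEQ_inverse_real_of_nat, of x] by (simp add: inverse_eq_divide)
  have "x - 1 / of_nat (Suc n) \<le> of_int \<lfloor>of_nat (Suc n) * x\<rfloor> / of_nat (Suc n)" for n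
  proof -
    have "of_nat (Suc n) * x - 1 \<le> of_int \<lfloor>of_nat (Suc n) * x\<rfloor>" by linarith
    from divide_right_mono[OF this, of "of_nat (Suc n)"] show ?thesis
      by (simp add: diff_divide_distrib)
  qed
  then show "\<forall>\<^sub>F n in sequentially. x - 1 / of_nat (Suc n) \<le> of_int \<lfloor>of_nat (Suc n) * x\<rfloor> / of_nat (Suc n)"
    by simp
  have "of_int \<lfloor>of_nat (Suc n) * x\<rfloor> / of_nat (Suc n) \<le> x" for n
    using divide_right_mono[OF of_int_floor_le[of "of_nat (Suc n) * x"], of "of_nat (Suc n)"] by simp
  then show "\<forall>\<^sub>F n in sequentially. of_int \<lfloor>of_nat (Suc n) * x\<rfloor> / of_nat (Suc n) \<le> x" by simp
qed auto

text \<open>A field with continuous paths is the pointwise limit of step functions in the first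
  variable, hence jointly measurable up to the exceptional set.\<close>

lemma jointly_measurable_version:
  fixes f :: "real \<Rightarrow> 'w \<Rightarrow> real"
  assumes [measurable]: "\<And>x. f x \<in> borel_measurable P"
  obtains g where "case_prod g \<in> borel_measurable (borel \<Otimes>\<^sub>M P)"
    "\<And>\<omega>. continuous_on UNIV (\<lambda>x. f x \<omega>) \<Longrightarrow> (\<lambda>x. g x \<omega>) = (\<lambda>x. f x \<omega>)"
proof
  define q where "q n x = \<lfloor>of_nat (Suc n) * x\<rfloor>" for n and x :: real
  \<comment> \<open>The total function \<open>lim\<close> makes \<open>g\<close> jointly measurable
    without exception; on discontinuous paths its values are irrelevant.\<close>
  define g where "g x \<omega> = lim (\<lambda>n. f (of_int (q n x) / of_nat (Suc n)) \<omega>)" for x \<omega>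
  have "(\<lambda>p. f (of_int (q n (fst p)) / of_nat (Suc n)) (snd p)) \<in> borel_measurable (borel \<Otimes>\<^sub>M P)" for n
    \<comment> \<open>The rounded argument takes countably many values, and on each of them only a
      fixed random variable occurs.\<close>
    unfolding q_def by (rule measurable_compose_countable[of "\<lambda>i p. f (of_int i / of_nat (Suc n)) (snd p)"]) measurable
  then show "case_prod g \<in> borel_measurable (borel \<Otimes>\<^sub>M P)"
    unfolding g_def case_prod_unfold by (rule borel_measurable_lim_metric)
  fix \<omega> assume "continuous_on UNIV (\<lambda>x. f x \<omega>)"
  then have "(\<lambda>n. f (of_int (q n x) / of_nat (Suc n)) \<omega>) \<longlonglongrightarrow> f x \<omega>" for x
    unfolding q_def by (rule continuous_on_tendsto_compose[OF _ LIMSEQ_floor_mult_div]) auto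
  then show "(\<lambda>x. g x \<omega>) = (\<lambda>x. f x \<omega>)" unfolding g_def by (intro ext limI)
qed

section \<open>Families of random fields: moderate and null representatives\<close>

lemma E_ML0_iff:
  "u \<in> E_ML0 P \<longleftrightarrow> (\<forall>x. \<forall>\<epsilon>\<in>{0<..1}. (\<lambda>\<omega>. u \<epsilon> x \<omega>) \<in> borel_measurable P) \<and>
     (AE \<omega> in P. (\<lambda>\<epsilon> x. u \<epsilon> x \<omega>) \<in> E_M)"
proof -
  have "AE \<omega> in P. \<forall>\<epsilon>\<in>{0<..1}. (\<lambda>x. u \<epsilon> x \<omega>) \<in> C_infinity" if "AE \<omega> in P. (\<lambda>\<epsilon> x. u \<epsilon> x \<omega>) \<in> E_M"
    using that by eventually_elim (auto simp: E_M_def)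
  then show ?thesis unfolding E_ML0_def by blast
qed

lemma N_L0_iff:
  "u \<in> N_L0 P \<longleftrightarrow> u \<in> E_ML0 P \<and> (AE \<omega> in P. loc_negligible (\<lambda>\<epsilon> x. u \<epsilon> x \<omega>))"
proof -
  have "AE \<omega> in P. \<forall>\<epsilon>\<in>{0<..1}. (\<lambda>x. u \<epsilon> x \<omega>) \<in> C_infinity"
    if "AE \<omega> in P. (\<lambda>\<epsilon> x. u \<epsilon> x \<omega>) \<in> N_null"
    using that by eventually_elim (auto simp: N_null_def)
  then have "u \<in> N_L0 P \<longleftrightarrow> (\<forall>x. \<forall>\<epsilon>\<in>{0<..1}. (\<lambda>\<omega>. u \<epsilon> x \<omega>) \<in> borel_measurable P) \<and>
      (AE \<omega> in P. (\<lambda>\<epsilon> x. u \<epsilon> x \<omega>) \<in> N_null)"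
    unfolding N_L0_def by blast
  then show ?thesis unfolding E_ML0_iff N_null_eq by simp
qed

lemma E_ML0_measurable:
  "u \<in> E_ML0 P \<Longrightarrow> \<epsilon> \<in> {0<..1} \<Longrightarrow> u \<epsilon> x \<in> borel_measurable P"
  unfolding E_ML0_def by blast

lemma E_ML0_AE: "u \<in> E_ML0 P \<Longrightarrow> AE \<omega> in P. (\<lambda>\<epsilon> x. u \<epsilon> x \<omega>) \<in> E_M"
  unfolding E_ML0_def by blast

lemma E_ML0_const: "(\<lambda>\<epsilon> x \<omega>. c) \<in> E_ML0 P"
  unfolding E_ML0_iff by (simp add: E_M_const)

lemma E_ML0_add:
  assumes "u \<in> E_ML0 P" "v \<in> E_ML0 P"
  shows "(\<lambda>\<epsilon> x \<omega>. u \<epsilon> x \<omega> + v \<epsilon> x \<omega>) \<in> E_ML0 P"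
proof -
  have "AE \<omega> in P. (\<lambda>\<epsilon> x. u \<epsilon> x \<omega> + v \<epsilon> x \<omega>) \<in> E_M"
    using assms[THEN E_ML0_AE] by eventually_elim (rule E_M_add)
  then show ?thesis using assms[THEN E_ML0_measurable] unfolding E_ML0_iff by auto
qed

lemma E_ML0_mult:
  assumes "u \<in> E_ML0 P" "v \<in> E_ML0 P"
  shows "(\<lambda>\<epsilon> x \<omega>. u \<epsilon> x \<omega> * v \<epsilon> x \<omega>) \<in> E_ML0 P"
proof -
  have "AE \<omega> in P. (\<lambda>\<epsilon> x. u \<epsilon> x \<omega> * v \<epsilon> x \<omega>) \<in> E_M"
    using assms[THEN E_ML0_AE] by eventually_elim (rule E_M_mult)
  then show ?thesis using assms[THEN E_ML0_measurable] unfolding E_ML0_iff by auto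
qed

lemma E_ML0_diff:
  assumes "u \<in> E_ML0 P" "v \<in> E_ML0 P"
  shows "(\<lambda>\<epsilon> x \<omega>. u \<epsilon> x \<omega> - v \<epsilon> x \<omega>) \<in> E_ML0 P"
  using E_ML0_add[OF assms(1) E_ML0_mult[OF E_ML0_const[of "-1"] assms(2)]] by simp

text \<open>On smooth paths the derivative is the limit of difference quotients along
  \<open>h = 1 / Suc n\<close>, and a limit of a sequence of random variables is measurable;
  completeness takes care of the remaining paths.\<close>

lemma E_ML0_partial_deriv:
  fixes u :: "('a::euclidean_space, 'w) rfields"
  assumes P: "complete_measure P" and u: "u \<in> E_ML0 P" and b: "b \<in> Basis"
  shows "(\<lambda>\<epsilon> x \<omega>. partial_deriv b (\<lambda>y. u \<epsilon> y \<omega>) x) \<in> E_ML0 P"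
  unfolding E_ML0_iff
proof (intro conjI allI ballI)
  show "AE \<omega> in P. (\<lambda>\<epsilon> x. partial_deriv b (\<lambda>y. u \<epsilon> y \<omega>) x) \<in> E_M"
    using E_ML0_AE[OF u] by eventually_elim (rule E_M_partial_deriv[OF _ b])
  fix x :: 'a and \<epsilon> :: real assume e: "\<epsilon> \<in> {0<..1}"
  note [measurable] = E_ML0_measurable[OF u e]
  have "(\<lambda>\<omega>. lim (\<lambda>n. (u \<epsilon> (x + inverse (of_nat (Suc n)) *\<^sub>R b) \<omega> - u \<epsilon> x \<omega>) / inverse (of_nat (Suc n))))
      \<in> borel_measurable P" by measurable
  moreover have "AE \<omega> in P. lim (\<lambda>n. (u \<epsilon> (x + inverse (of_nat (Suc n)) *\<^sub>R b) \<omega> - u \<epsilon> x \<omega>) /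
      inverse (of_nat (Suc n))) = partial_deriv b (\<lambda>y. u \<epsilon> y \<omega>) x"
    using E_ML0_AE[OF u]
  proof eventually_elim
    case (elim \<omega>)
    have "((\<lambda>h. (u \<epsilon> (x + h *\<^sub>R b) \<omega> - u \<epsilon> x \<omega>) / h) \<longlongrightarrow> partial_deriv b (\<lambda>y. u \<epsilon> y \<omega>) x) (at 0)"
      using C_infinity_has_derivative[OF E_M_C_infinity[OF elim e] b, of x] by (simp add: DERIV_def)
    moreover have "filterlim (\<lambda>n. inverse (of_nat (Suc n)) :: real) (at 0) sequentially"
      using LIMSEQ_inverse_real_of_nat by (simp add: filterlim_at)
    ultimately show ?case by (intro limI) (rule filterlim_compose)
  qed
  ultimately show "(\<lambda>\<omega>. partial_deriv b (\<lambda>y. u \<epsilon> y \<omega>) x) \<in> borel_measurable P"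
    by (rule complete_measure.borel_measurable_AE_eq[OF P])
qed

lemma N_L0_E_ML0: "u \<in> N_L0 P \<Longrightarrow> u \<in> E_ML0 P"
  by (simp add: N_L0_iff)

lemma N_L0_0: "(\<lambda>\<epsilon> x \<omega>. 0) \<in> N_L0 P"
  by (simp add: N_L0_iff E_ML0_const loc_negligible_0)

lemma N_L0_add:
  assumes "u \<in> N_L0 P" "v \<in> N_L0 P"
  shows "(\<lambda>\<epsilon> x \<omega>. u \<epsilon> x \<omega> + v \<epsilon> x \<omega>) \<in> N_L0 P"
proof -
  have "AE \<omega> in P. loc_negligible (\<lambda>\<epsilon> x. u \<epsilon> x \<omega>)" "AE \<omega> in P. loc_negligible (\<lambda>\<epsilon> x. v \<epsilon> x \<omega>)"
    using assms by (simp_all add: N_L0_iff)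
  then have "AE \<omega> in P. loc_negligible (\<lambda>\<epsilon> x. u \<epsilon> x \<omega> + v \<epsilon> x \<omega>)"
    by eventually_elim (rule loc_negligible_add)
  then show ?thesis using assms by (simp add: N_L0_iff E_ML0_add)
qed

lemma N_L0_mult:
  assumes "u \<in> N_L0 P" "v \<in> E_ML0 P"
  shows "(\<lambda>\<epsilon> x \<omega>. u \<epsilon> x \<omega> * v \<epsilon> x \<omega>) \<in> N_L0 P"
proof -
  have "AE \<omega> in P. loc_negligible (\<lambda>\<epsilon> x. u \<epsilon> x \<omega>)"
    using assms by (simp add: N_L0_iff)
  then have "AE \<omega> in P. loc_negligible (\<lambda>\<epsilon> x. u \<epsilon> x \<omega> * v \<epsilon> x \<omega>)"
    using E_ML0_AE[OF assms(2)]
    by eventually_elim (rule loc_negligible_mult[OF _ E_M_loc_moderate])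
  then show ?thesis using assms by (simp add: N_L0_iff E_ML0_mult)
qed

lemma N_L0_uminus: "u \<in> N_L0 P \<Longrightarrow> (\<lambda>\<epsilon> x \<omega>. - u \<epsilon> x \<omega>) \<in> N_L0 P"
  using N_L0_mult[OF _ E_ML0_const[of "-1"]] by force

lemma N_L0_diff_commute:
  "(\<lambda>\<epsilon> x \<omega>. u \<epsilon> x \<omega> - v \<epsilon> x \<omega>) \<in> N_L0 P \<Longrightarrow> (\<lambda>\<epsilon> x \<omega>. v \<epsilon> x \<omega> - u \<epsilon> x \<omega>) \<in> N_L0 P"
  using N_L0_uminus by force

section \<open>The quotient and its operations computed on representatives\<close>

lemma equiv_L0_rel: "equiv (E_ML0 P) (L0_rel P)"
proof (rule equivI)
  show "L0_rel P \<subseteq> E_ML0 P \<times> E_ML0 P" by (auto simp: L0_rel_def)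
  show "refl_on (E_ML0 P) (L0_rel P)" by (auto simp: L0_rel_def refl_on_def N_L0_0)
  show "sym (L0_rel P)" by (auto simp: L0_rel_def sym_def intro: N_L0_diff_commute)
  show "trans (L0_rel P)"
  proof (rule transI)
    fix u v w assume "(u, v) \<in> L0_rel P" "(v, w) \<in> L0_rel P"
    then show "(u, w) \<in> L0_rel P"
      using N_L0_add[of "\<lambda>\<epsilon> x \<omega>. u \<epsilon> x \<omega> - v \<epsilon> x \<omega>" P "\<lambda>\<epsilon> x \<omega>. v \<epsilon> x \<omega> - w \<epsilon> x \<omega>"]
      by (auto simp: L0_rel_def)
  qed
qed

lemma G_class_eq_iff:
  "u \<in> E_ML0 P \<Longrightarrow> v \<in> E_ML0 P \<Longrightarrow>
    G_class P u = G_class P v \<longleftrightarrow> (\<lambda>\<epsilon> x \<omega>. u \<epsilon> x \<omega> - v \<epsilon> x \<omega>) \<in> N_L0 P"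
  unfolding G_class_def by (subst eq_equiv_class_iff[OF equiv_L0_rel]) (auto simp: L0_rel_def)

lemma G_class_in_G_L0: "u \<in> E_ML0 P \<Longrightarrow> G_class P u \<in> G_L0 P"
  unfolding G_class_def G_L0_def by (rule quotientI)

lemma G_L0_cases:
  assumes "U \<in> G_L0 P"
  obtains u where "u \<in> E_ML0 P" "U = G_class P u"
  using assms unfolding G_class_def G_L0_def by (elim quotientE)

lemma G_L0_representative:
  assumes "U \<in> G_L0 P" "u \<in> U"
  shows "u \<in> E_ML0 P" "U = G_class P u"
proof -
  obtain v where v: "v \<in> E_ML0 P" "U = G_class P v" using G_L0_cases[OF assms(1)] .
  with assms(2) have "(v, u) \<in> L0_rel P" by (simp add: G_class_def)
  then show "u \<in> E_ML0 P" "U = G_class P u"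
    using equiv_class_eq[OF equiv_L0_rel] v(2) by (auto simp: L0_rel_def G_class_def)
qed

text \<open>If \<open>F\<close> respects null differences, all classes in the union coincide. This
  turns each operation defined by a union over representatives into a single class.\<close>

lemma UN_G_class:
  assumes u: "u \<in> E_ML0 P"
    and F: "\<And>v. v \<in> E_ML0 P \<Longrightarrow> F v \<in> E_ML0 P"
    and resp: "\<And>v. v \<in> E_ML0 P \<Longrightarrow> (\<lambda>\<epsilon> x \<omega>. v \<epsilon> x \<omega> - u \<epsilon> x \<omega>) \<in> N_L0 P \<Longrightarrow>
      (\<lambda>\<epsilon> x \<omega>. F v \<epsilon> x \<omega> - F u \<epsilon> x \<omega>) \<in> N_L0 P"
  shows "(\<Union>v\<in>G_class P u. G_class P (F v)) = G_class P (F u)"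
proof (rule UN_constant_eq)
  show "u \<in> G_class P u" using equiv_class_self[OF equiv_L0_rel u] by (simp add: G_class_def)
  show "\<forall>v\<in>G_class P u. G_class P (F v) = G_class P (F u)"
  proof
    fix v assume "v \<in> G_class P u"
    then have "v \<in> E_ML0 P" "(\<lambda>\<epsilon> x \<omega>. v \<epsilon> x \<omega> - u \<epsilon> x \<omega>) \<in> N_L0 P"
      by (auto simp: G_class_def L0_rel_def intro: N_L0_diff_commute)
    then show "G_class P (F v) = G_class P (F u)"
      using G_class_eq_iff F u resp by blast
  qed
qed

lemma G_add_class:
  assumes u: "u \<in> E_ML0 P" and v: "v \<in> E_ML0 P"
  shows "G_add P (G_class P u) (G_class P v) = G_class P (\<lambda>\<epsilon> x \<omega>. u \<epsilon> x \<omega> + v \<epsilon> x \<omega>)"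
proof -
  \<comment> \<open>The union over two representatives is collapsed one variable at a time, with the
    other one held fixed.\<close>
  have "(\<Union>v'\<in>G_class P v. G_class P (\<lambda>\<epsilon> x \<omega>. u' \<epsilon> x \<omega> + v' \<epsilon> x \<omega>)) =
      G_class P (\<lambda>\<epsilon> x \<omega>. u' \<epsilon> x \<omega> + v \<epsilon> x \<omega>)" if "u' \<in> G_class P u" for u'
    using that v by (intro UN_G_class) (auto intro: E_ML0_add simp: G_class_def L0_rel_def)
  then have "G_add P (G_class P u) (G_class P v) =
      (\<Union>u'\<in>G_class P u. G_class P (\<lambda>\<epsilon> x \<omega>. u' \<epsilon> x \<omega> + v \<epsilon> x \<omega>))"
    unfolding G_add_def by simp
  also have "\<dots> = G_class P (\<lambda>\<epsilon> x \<omega>. u \<epsilon> x \<omega> + v \<epsilon> x \<omega>)"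
    using u v by (intro UN_G_class) (auto intro: E_ML0_add)
  finally show ?thesis .
qed

text \<open>Null families form an ideal among the moderate ones; exchanging one factor at a time
  changes the product by a null family times a moderate one.\<close>

lemma G_mult_class:
  assumes u: "u \<in> E_ML0 P" and v: "v \<in> E_ML0 P"
  shows "G_mult P (G_class P u) (G_class P v) = G_class P (\<lambda>\<epsilon> x \<omega>. u \<epsilon> x \<omega> * v \<epsilon> x \<omega>)"
proof -
  have "(\<Union>v'\<in>G_class P v. G_class P (\<lambda>\<epsilon> x \<omega>. u' \<epsilon> x \<omega> * v' \<epsilon> x \<omega>)) =
      G_class P (\<lambda>\<epsilon> x \<omega>. u' \<epsilon> x \<omega> * v \<epsilon> x \<omega>)" if "u' \<in> G_class P u" for u'
  proof (rule UN_G_class[OF v])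
    have u': "u' \<in> E_ML0 P" using that by (simp add: G_class_def L0_rel_def)
    then show "(\<lambda>\<epsilon> x \<omega>. u' \<epsilon> x \<omega> * v' \<epsilon> x \<omega>) \<in> E_ML0 P" if "v' \<in> E_ML0 P" for v'
      using that by (rule E_ML0_mult)
    show "(\<lambda>\<epsilon> x \<omega>. u' \<epsilon> x \<omega> * v' \<epsilon> x \<omega> - u' \<epsilon> x \<omega> * v \<epsilon> x \<omega>) \<in> N_L0 P"
      if "(\<lambda>\<epsilon> x \<omega>. v' \<epsilon> x \<omega> - v \<epsilon> x \<omega>) \<in> N_L0 P" for v'
      using N_L0_mult[OF that u'] by (simp add: algebra_simps)
  qed
  then have "G_mult P (G_class P u) (G_class P v) =
      (\<Union>u'\<in>G_class P u. G_class P (\<lambda>\<epsilon> x \<omega>. u' \<epsilon> x \<omega> * v \<epsilon> x \<omega>))"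
    unfolding G_mult_def by simp
  also have "\<dots> = G_class P (\<lambda>\<epsilon> x \<omega>. u \<epsilon> x \<omega> * v \<epsilon> x \<omega>)"
  proof (rule UN_G_class[OF u E_ML0_mult[OF _ v]])
    show "(\<lambda>\<epsilon> x \<omega>. u' \<epsilon> x \<omega> * v \<epsilon> x \<omega> - u \<epsilon> x \<omega> * v \<epsilon> x \<omega>) \<in> N_L0 P"
      if "(\<lambda>\<epsilon> x \<omega>. u' \<epsilon> x \<omega> - u \<epsilon> x \<omega>) \<in> N_L0 P" for u'
      using N_L0_mult[OF that v] by (simp add: algebra_simps)
  qed
  finally show ?thesis .
qed

lemma C_infinity_partial_deriv_diff:
  assumes "f \<in> C_infinity" "g \<in> C_infinity" "b \<in> Basis"
  shows "partial_deriv b (\<lambda>y. f y - g y) x = partial_deriv b f x - partial_deriv b g x"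
  by (intro partial_deriv_eqI DERIV_diff C_infinity_has_derivative assms)

lemma G_deriv_class:
  fixes u :: "('a::euclidean_space, 'w) rfields"
  assumes P: "complete_measure P" and u: "u \<in> E_ML0 P" and b: "b \<in> Basis"
  shows "G_deriv P b (G_class P u) = G_class P (\<lambda>\<epsilon> x \<omega>. partial_deriv b (\<lambda>y. u \<epsilon> y \<omega>) x)"
  unfolding G_deriv_def
proof (rule UN_G_class[OF u E_ML0_partial_deriv[OF P _ b]])
  fix v assume v: "v \<in> E_ML0 P" and n: "(\<lambda>\<epsilon> x \<omega>. v \<epsilon> x \<omega> - u \<epsilon> x \<omega>) \<in> N_L0 P"
  have neg: "AE \<omega> in P. loc_negligible (\<lambda>\<epsilon> x. v \<epsilon> x \<omega> - u \<epsilon> x \<omega>)" using n by (simp add: N_L0_iff)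
  have "AE \<omega> in P. loc_negligible (\<lambda>\<epsilon> x. partial_deriv b (\<lambda>y. v \<epsilon> y \<omega>) x - partial_deriv b (\<lambda>y. u \<epsilon> y \<omega>) x)"
    using E_ML0_AE[OF u] E_ML0_AE[OF v] neg
  proof eventually_elim
    case (elim \<omega>)
    then show ?case
      by (intro loc_negligible_cong[OF loc_negligible_partial_deriv[OF E_M_diff[OF elim(2,1)] elim(3) b]]
          C_infinity_partial_deriv_diff[OF _ _ b] E_M_C_infinity[OF elim(1)] E_M_C_infinity[OF elim(2)])
  qed
  then show "(\<lambda>\<epsilon> x \<omega>. partial_deriv b (\<lambda>y. v \<epsilon> y \<omega>) x - partial_deriv b (\<lambda>y. u \<epsilon> y \<omega>) x) \<in> N_L0 P"
    by (simp add: N_L0_iff E_ML0_diff E_ML0_partial_deriv[OF P _ b] u v)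
qed

section \<open>Restriction to the initial line and processes in time as fields in the plane\<close>

lemma E_ML0_restrict_t0:
  fixes u :: "(real \<times> real, 'w) rfields"
  assumes "u \<in> E_ML0 P"
  shows "(\<lambda>\<epsilon> x \<omega>. u \<epsilon> (x, 0) \<omega>) \<in> E_ML0 P"
proof -
  have "AE \<omega> in P. (\<lambda>\<epsilon> x. u \<epsilon> (x, 0) \<omega>) \<in> E_M"
    using E_ML0_AE[OF assms] by eventually_elim (rule time_zero_E_M)
  then show ?thesis using E_ML0_measurable[OF assms] unfolding E_ML0_iff by auto
qed

lemma loc_negligible_time_zero:
  fixes u :: "real \<Rightarrow> real \<times> real \<Rightarrow> real"
  assumes "loc_negligible u"
  shows "loc_negligible (\<lambda>\<epsilon> x. u \<epsilon> (x, 0))"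
  unfolding loc_negligible_def
proof (intro allI impI)
  fix K :: "real set" and N :: nat assume "compact K"
  then have "compact (K \<times> {0::real})" by (intro compact_Times) auto
  then have "\<forall>\<^sub>F \<epsilon> in at_right 0. \<forall>p\<in>K \<times> {0}. \<bar>u \<epsilon> p\<bar> \<le> \<epsilon> ^ N"
    using assms unfolding loc_negligible_def by blast
  then show "\<forall>\<^sub>F \<epsilon> in at_right 0. \<forall>x\<in>K. \<bar>u \<epsilon> (x, 0)\<bar> \<le> \<epsilon> ^ N"
    by eventually_elim auto
qed

lemma loc_negligible_time:
  fixes v :: "real \<Rightarrow> real \<Rightarrow> real"
  assumes "loc_negligible v"
  shows "loc_negligible (\<lambda>\<epsilon> p. v \<epsilon> (snd (p :: real \<times> real)))"
  unfolding loc_negligible_def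
proof (intro allI impI)
  fix K :: "(real \<times> real) set" and N :: nat assume "compact K"
  then have "compact (snd ` K)"
    by (rule compact_continuous_image[OF continuous_on_snd[OF continuous_on_id]])
  then have "\<forall>\<^sub>F \<epsilon> in at_right 0. \<forall>t\<in>snd ` K. \<bar>v \<epsilon> t\<bar> \<le> \<epsilon> ^ N"
    using assms unfolding loc_negligible_def by blast
  then show "\<forall>\<^sub>F \<epsilon> in at_right 0. \<forall>p\<in>K. \<bar>v \<epsilon> (snd p)\<bar> \<le> \<epsilon> ^ N"
    by eventually_elim auto
qed

lemma G_restrict_t0_class:
  assumes u: "u \<in> E_ML0 P"
  shows "G_restrict_t0 P (G_class P u) = G_class P (\<lambda>\<epsilon> x \<omega>. u \<epsilon> (x, 0) \<omega>)"
  unfolding G_restrict_t0_def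
proof (rule UN_G_class[OF u E_ML0_restrict_t0])
  fix v assume n: "(\<lambda>\<epsilon> x \<omega>. v \<epsilon> x \<omega> - u \<epsilon> x \<omega>) \<in> N_L0 P"
  then have "AE \<omega> in P. loc_negligible (\<lambda>\<epsilon> p. v \<epsilon> p \<omega> - u \<epsilon> p \<omega>)" by (simp add: N_L0_iff)
  then have "AE \<omega> in P. loc_negligible (\<lambda>\<epsilon> x. v \<epsilon> (x, 0) \<omega> - u \<epsilon> (x, 0) \<omega>)"
    by eventually_elim (rule loc_negligible_time_zero)
  then show "(\<lambda>\<epsilon> x \<omega>. v \<epsilon> (x, 0) \<omega> - u \<epsilon> (x, 0) \<omega>) \<in> N_L0 P"
    using E_ML0_restrict_t0[OF N_L0_E_ML0[OF n]] by (simp add: N_L0_iff)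
qed

lemma E_ML0_of_t:
  fixes v :: "(real, 'w) rfields"
  assumes "v \<in> E_ML0 P"
  shows "(\<lambda>\<epsilon> p \<omega>. v \<epsilon> (snd (p :: real \<times> real)) \<omega>) \<in> E_ML0 P"
proof -
  have "AE \<omega> in P. (\<lambda>\<epsilon> p. v \<epsilon> (snd (p :: real \<times> real)) \<omega>) \<in> E_M"
    using E_ML0_AE[OF assms] by eventually_elim (rule time_E_M)
  then show ?thesis using E_ML0_measurable[OF assms] unfolding E_ML0_iff by auto
qed

lemma G_of_t_class:
  assumes v: "v \<in> E_ML0 P"
  shows "G_of_t P (G_class P v) = G_class P (\<lambda>\<epsilon> p \<omega>. v \<epsilon> (snd p) \<omega>)"
proof -
  have *: "(\<lambda>\<epsilon> (x :: real, t) \<omega>. w \<epsilon> t \<omega>) = (\<lambda>\<epsilon> p \<omega>. w \<epsilon> (snd p) \<omega>)" for w :: "(real, 'a) rfields"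
    by (simp add: fun_eq_iff split_beta)
  show ?thesis unfolding G_of_t_def *
  proof (rule UN_G_class[OF v E_ML0_of_t])
    fix w assume n: "(\<lambda>\<epsilon> x \<omega>. w \<epsilon> x \<omega> - v \<epsilon> x \<omega>) \<in> N_L0 P"
    then have "AE \<omega> in P. loc_negligible (\<lambda>\<epsilon> t. w \<epsilon> t \<omega> - v \<epsilon> t \<omega>)" by (simp add: N_L0_iff)
    then have "AE \<omega> in P. loc_negligible (\<lambda>\<epsilon> p. w \<epsilon> (snd (p :: real \<times> real)) \<omega> - v \<epsilon> (snd p) \<omega>)"
      by eventually_elim (rule loc_negligible_time)
    then show "(\<lambda>\<epsilon> p \<omega>. w \<epsilon> (snd (p :: real \<times> real)) \<omega> - v \<epsilon> (snd p) \<omega>) \<in> N_L0 P"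
      using E_ML0_of_t[OF N_L0_E_ML0[OF n]] by (simp add: N_L0_iff)
  qed
qed

section \<open>The transport problem\<close>

text \<open>The antiderivative at \<open>t\<close> is bounded by the integral of the absolute value
  over an interval containing 0 and \<open>t\<close>. The intervals run through a countable family
  so that a single null set will suffice.\<close>

lemma characteristics_antiderivative:
  assumes l: "l \<in> E_M"
    and L1: "\<And>n::nat. \<exists>c>0. \<forall>\<epsilon>\<in>{0<..1}.
      (\<integral>\<^sup>+ t\<in>{- real n..real n}. ennreal \<bar>l \<epsilon> t\<bar> \<partial>lborel) \<le> ennreal c"
  shows "characteristics l (\<lambda>\<epsilon> t. LBINT s=ereal 0..ereal t. l \<epsilon> s)"
proof
  have cont: "continuous_on S (l \<epsilon>)" if "\<epsilon> \<in> {0<..1}" for S \<epsilon>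
    using C_infinity_continuous[OF E_M_C_infinity[OF l that]] continuous_on_subset by blast
  show "((\<lambda>t. LBINT s=ereal 0..ereal t. l \<epsilon> s) has_real_derivative l \<epsilon> t) (at t)"
    if e: "\<epsilon> \<in> {0<..1}" for \<epsilon> t
  proof -
    \<comment> \<open>The interval has both 0 and \<open>t\<close> in its interior, so the one-sided
      restriction in the fundamental theorem disappears.\<close>
    have "((\<lambda>t. LBINT s=ereal 0..ereal t. l \<epsilon> s) has_vector_derivative l \<epsilon> t)
        (at t within {- \<bar>t\<bar> - 1..\<bar>t\<bar> + 1})"
      by (rule interval_integral_FTC2[OF _ _ cont[OF e]]) auto
    moreover have "at t within {- \<bar>t\<bar> - 1..\<bar>t\<bar> + 1} = at t"
      by (rule at_within_Icc_at) auto
    ultimately show ?thesis by (simp add: has_real_derivative_iff_has_vector_derivative)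
  qed
  show "\<exists>C. \<forall>\<epsilon>\<in>{0<..1}. \<forall>t. \<bar>t\<bar> \<le> T \<longrightarrow> \<bar>LBINT s=ereal 0..ereal t. l \<epsilon> s\<bar> \<le> C" for T
  proof -
    obtain n :: nat where n: "T \<le> n" using real_arch_simple by blast
    obtain c where c: "c > 0" "\<And>\<epsilon>. \<epsilon> \<in> {0<..1} \<Longrightarrow>
        (\<integral>\<^sup>+ t\<in>{- real n..real n}. ennreal \<bar>l \<epsilon> t\<bar> \<partial>lborel) \<le> ennreal c" using L1 by blast
    have "\<bar>LBINT s=ereal 0..ereal t. l \<epsilon> s\<bar> \<le> c" if e: "\<epsilon> \<in> {0<..1}" and t: "\<bar>t\<bar> \<le> T" for \<epsilon> t
    proof -
      \<comment> \<open>The open interval between 0 and \<open>t\<close> for either sign of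
        \<open>t\<close>; the oriented integral is plus or minus the integral over
        \<open>S\<close>.\<close>
      define S where "S = {min 0 t<..<max 0 t}"
      have "set_integrable lborel {- real n..real n} (l \<epsilon>)"
        by (rule borel_integrable_atLeastAtMost'[OF cont[OF e]])
      then have "set_integrable lborel S (l \<epsilon>)"
        by (rule set_integrable_subset) (use t n in \<open>auto simp: S_def\<close>)
      then have "ennreal (norm (LINT s:S|lborel. l \<epsilon> s)) \<le>
          (\<integral>\<^sup>+ s. ennreal (norm (indicator S s *\<^sub>R l \<epsilon> s)) \<partial>lborel)"
        unfolding set_integrable_def set_lebesgue_integral_def by (rule integral_norm_bound_ennreal)
      also have "\<dots> \<le> (\<integral>\<^sup>+ s\<in>{- real n..real n}. ennreal \<bar>l \<epsilon> s\<bar> \<partial>lborel)"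
        by (rule nn_integral_mono) (use t n in \<open>auto simp: S_def indicator_def\<close>)
      also have "\<dots> \<le> ennreal c" by (rule c(2)[OF e])
      finally have "\<bar>LINT s:S|lborel. l \<epsilon> s\<bar> \<le> c" using c(1) by (simp add: ennreal_le_iff)
      then show ?thesis
        by (cases "0 \<le> t") (auto simp: interval_lebesgue_integral_def S_def min_def max_def)
    qed
    then show ?thesis by blast
  qed
qed (use l in auto)

text \<open>Integrating out one variable preserves measurability for jointly measurable integrands,
  so the integral is computed with the joint version, which has the same paths almost
  surely.\<close>

lemma borel_measurable_path_integral:
  fixes f :: "real \<Rightarrow> 'w \<Rightarrow> real"
  assumes P: "complete_measure P" and f: "\<And>x. f x \<in> borel_measurable P"
    and cont: "AE \<omega> in P. continuous_on UNIV (\<lambda>x. f x \<omega>)"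
  shows "(\<lambda>\<omega>. LBINT s=ereal a..ereal b. f s \<omega>) \<in> borel_measurable P"
proof -
  obtain g where g[measurable]: "case_prod g \<in> borel_measurable (borel \<Otimes>\<^sub>M P)"
    and eq: "\<And>\<omega>. continuous_on UNIV (\<lambda>x. f x \<omega>) \<Longrightarrow> (\<lambda>x. g x \<omega>) = (\<lambda>x. f x \<omega>)"
    by (rule jointly_measurable_version[of f P, OF f]) (rule that)
  have "(\<lambda>\<omega>. LINT s:{c<..<d}|lborel. g s \<omega>) \<in> borel_measurable P" for c d
    unfolding set_lebesgue_integral_def by measurable
  then have "(\<lambda>\<omega>. LBINT s=ereal a..ereal b. g s \<omega>) \<in> borel_measurable P"
    unfolding interval_lebesgue_integral_def by (cases "a \<le> b") auto
  moreover have "AE \<omega> in P. (LBINT s=ereal a..ereal b. g s \<omega>) = (LBINT s=ereal a..ereal b. f s \<omega>)"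
    using cont
  proof eventually_elim
    case (elim \<omega>)
    show ?case unfolding eq[OF elim] ..
  qed
  ultimately show ?thesis by (rule complete_measure.borel_measurable_AE_eq[OF P])
qed

text \<open>Evaluation at a random point calls for joint measurability; measurability at each fixed
  point is not sufficient by itself.\<close>

lemma borel_measurable_path_compose:
  fixes f :: "real \<Rightarrow> 'w \<Rightarrow> real"
  assumes P: "complete_measure P" and f: "\<And>x. f x \<in> borel_measurable P"
    and cont: "AE \<omega> in P. continuous_on UNIV (\<lambda>x. f x \<omega>)"
    and X[measurable]: "X \<in> borel_measurable P"
  shows "(\<lambda>\<omega>. f (X \<omega>) \<omega>) \<in> borel_measurable P"
proof -
  obtain g where g[measurable]: "case_prod g \<in> borel_measurable (borel \<Otimes>\<^sub>M P)"
    and eq: "\<And>\<omega>. continuous_on UNIV (\<lambda>x. f x \<omega>) \<Longrightarrow> (\<lambda>x. g x \<omega>) = (\<lambda>x. f x \<omega>)"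
    by (rule jointly_measurable_version[of f P, OF f]) (rule that)
  have "(\<lambda>\<omega>. g (X \<omega>) \<omega>) \<in> borel_measurable P" by measurable
  moreover have "AE \<omega> in P. g (X \<omega>) \<omega> = f (X \<omega>) \<omega>"
    using cont by eventually_elim (metis eq)
  ultimately show ?thesis by (rule complete_measure.borel_measurable_AE_eq[OF P])
qed

lemma E_ML0_continuous_paths:
  assumes "u \<in> E_ML0 P" "\<epsilon> \<in> {0<..1}"
  shows "AE \<omega> in P. continuous_on UNIV (\<lambda>x. u \<epsilon> x \<omega>)"
  using E_ML0_AE[OF assms(1)]
  by eventually_elim (rule C_infinity_continuous[OF E_M_C_infinity[OF _ assms(2)]])

definition transport_residual ::
    "(real, 'w) rfields \<Rightarrow> (real \<times> real, 'w) rfields \<Rightarrow> (real \<times> real, 'w) rfields" where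
  "transport_residual v u \<epsilon> p \<omega> =
     partial_deriv (0, 1) (\<lambda>y. u \<epsilon> y \<omega>) p + v \<epsilon> (snd p) \<omega> * partial_deriv (1, 0) (\<lambda>y. u \<epsilon> y \<omega>) p"

lemma E_ML0_transport_residual:
  assumes "complete_measure P" "v \<in> E_ML0 P" "u \<in> E_ML0 P"
  shows "transport_residual v u \<in> E_ML0 P"
  unfolding transport_residual_def[abs_def]
  using assms by (intro E_ML0_add E_ML0_mult E_ML0_partial_deriv E_ML0_of_t Basis_real_prod)

text \<open>Translates the equation between classes into nullity of one concrete family, to which
  pathwise arguments apply.\<close>

lemma transport_equation_iff:
  assumes P: "complete_measure P" and v: "v \<in> E_ML0 P" and u: "u \<in> E_ML0 P"
  shows "G_add P (G_deriv P (0, 1) (G_class P u))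
      (G_mult P (G_of_t P (G_class P v)) (G_deriv P (1, 0) (G_class P u))) = G_zero P \<longleftrightarrow>
    transport_residual v u \<in> N_L0 P"
proof -
  note E = E_ML0_partial_deriv[OF P u Basis_real_prod(1)] E_ML0_partial_deriv[OF P u Basis_real_prod(2)]
    E_ML0_of_t[OF v]
  have "G_add P (G_deriv P (0, 1) (G_class P u))
      (G_mult P (G_of_t P (G_class P v)) (G_deriv P (1, 0) (G_class P u))) =
      G_class P (transport_residual v u)"
    unfolding G_deriv_class[OF P u Basis_real_prod(1)] G_deriv_class[OF P u Basis_real_prod(2)]
      G_of_t_class[OF v] G_mult_class[OF E(3,1)] G_add_class[OF E(2) E_ML0_mult[OF E(3,1)]]
      transport_residual_def[abs_def] ..
  then show ?thesis
    using G_class_eq_iff[OF E_ML0_transport_residual[OF P v u] E_ML0_const[of 0]]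
    by (simp add: G_zero_def)
qed

theorem proposition5p1:
  fixes P :: "'w measure"
    and lam u0 :: "(real, 'w) rfields set"
  assumes "prob_space P"
    and "complete_measure P"
    and "lam \<in> G_L0 P"
    and "ac_local_L1_type P lam"
    and "u0 \<in> G_L0 P"
  shows "\<exists>!u :: (real \<times> real, 'w) rfields set.
    u \<in> G_L0 P \<and>
    G_add P (G_deriv P (0, 1) u) (G_mult P (G_of_t P lam) (G_deriv P (1, 0) u)) = G_zero P \<and>
    G_restrict_t0 P u = u0"
proof -
  note P = assms(2)
  \<comment> \<open>The integral bound is attached to this representative, so the characteristics
    are built from it.\<close>
  obtain v where "v \<in> lam"
    and L1: "\<And>K. compact K \<Longrightarrow> AE \<omega> in P. \<exists>c>0. \<forall>\<epsilon>\<in>{0<..1}.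
      (\<integral>\<^sup>+ t\<in>K. ennreal \<bar>v \<epsilon> t \<omega>\<bar> \<partial>lborel) \<le> ennreal c"
    using assms(4) unfolding ac_local_L1_type_def by blast
  then have v: "v \<in> E_ML0 P" and lam: "lam = G_class P v"
    using G_L0_representative[OF assms(3)] by blast+
  obtain w where w: "w \<in> E_ML0 P" and u0: "u0 = G_class P w"
    using G_L0_cases[OF assms(5)] .
  define L where "L \<epsilon> t \<omega> = (LBINT s=ereal 0..ereal t. v \<epsilon> s \<omega>)" for \<epsilon> t \<omega>
  \<comment> \<open>Each compact set has its own null set; exhausting the line by countably many
    intervals yields a common one.\<close>
  have "AE \<omega> in P. \<forall>n::nat. \<exists>c>0. \<forall>\<epsilon>\<in>{0<..1}.
      (\<integral>\<^sup>+ t\<in>{- real n..real n}. ennreal \<bar>v \<epsilon> t \<omega>\<bar> \<partial>lborel) \<le> ennreal c"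
    unfolding AE_all_countable by (intro allI L1) simp
  then have char: "AE \<omega> in P. characteristics (\<lambda>\<epsilon> t. v \<epsilon> t \<omega>) (\<lambda>\<epsilon> t. L \<epsilon> t \<omega>)"
    unfolding L_def using E_ML0_AE[OF v]
    by eventually_elim (rule characteristics_antiderivative, auto)
  define U where "U \<epsilon> p \<omega> = w \<epsilon> (fst p - L \<epsilon> (snd p) \<omega>) \<omega>" for \<epsilon> and p :: "real \<times> real" and \<omega>
  have U: "U \<in> E_ML0 P"
    unfolding E_ML0_iff
  proof (intro conjI allI ballI)
    show "AE \<omega> in P. (\<lambda>\<epsilon> p. U \<epsilon> p \<omega>) \<in> E_M"
      using char E_ML0_AE[OF w]
    proof eventually_elim
      case (elim \<omega>)
      then interpret characteristics "\<lambda>\<epsilon> t. v \<epsilon> t \<omega>" "\<lambda>\<epsilon> t. L \<epsilon> t \<omega>" by simp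
      show ?case
        using transported_E_M_and_time_E_M(1)[OF elim(2)] by (simp add: transported_def[abs_def] U_def)
    qed
    fix p :: "real \<times> real" and \<epsilon> :: real assume e: "\<epsilon> \<in> {0<..1}"
    have "L \<epsilon> (snd p) \<in> borel_measurable P" unfolding L_def
      by (rule borel_measurable_path_integral[OF P E_ML0_measurable[OF v e] E_ML0_continuous_paths[OF v e]])
    then show "(\<lambda>\<omega>. U \<epsilon> p \<omega>) \<in> borel_measurable P" unfolding U_def
      by (intro borel_measurable_path_compose[OF P E_ML0_measurable[OF w e] E_ML0_continuous_paths[OF w e]])
        auto
  qed
  \<comment> \<open>For almost every path the residual of \<open>U\<close> is exactly zero for all
    \<epsilon> in \<open>{0<..1}\<close>.\<close>
  have "AE \<omega> in P. loc_negligible (\<lambda>\<epsilon> p. transport_residual v U \<epsilon> p \<omega>)"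
    using char E_ML0_AE[OF w]
  proof eventually_elim
    case (elim \<omega>)
    then interpret characteristics "\<lambda>\<epsilon> t. v \<epsilon> t \<omega>" "\<lambda>\<epsilon> t. L \<epsilon> t \<omega>" by simp
    have "(\<lambda>y. U \<epsilon> y \<omega>) = transported (\<lambda>\<epsilon> x. w \<epsilon> x \<omega>) \<epsilon>" for \<epsilon>
      by (simp add: fun_eq_iff transported_def U_def)
    then show ?case
      using transported_solves[OF elim(2)]
      by (intro loc_negligible_cong[OF loc_negligible_0]) (simp add: transport_residual_def)
  qed
  then have "transport_residual v U \<in> N_L0 P"
    by (simp add: N_L0_iff E_ML0_transport_residual[OF P v U])
  then have U_eq: "G_add P (G_deriv P (0, 1) (G_class P U))
      (G_mult P (G_of_t P lam) (G_deriv P (1, 0) (G_class P U))) = G_zero P"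
    unfolding lam by (simp add: transport_equation_iff[OF P v U])
  \<comment> \<open>The integral from 0 to 0 vanishes for every \<omega>, so the initial values
    agree exactly, not just up to a null family.\<close>
  have "(\<lambda>\<epsilon> x \<omega>. U \<epsilon> (x, 0) \<omega>) = w"
    by (intro ext) (simp add: U_def L_def)
  then have U_init: "G_restrict_t0 P (G_class P U) = u0"
    unfolding u0 G_restrict_t0_class[OF U] by simp
  show ?thesis
  proof (intro ex1I[of _ "G_class P U"] conjI G_class_in_G_L0 U U_eq U_init)
    fix Y assume Y: "Y \<in> G_L0 P \<and>
      G_add P (G_deriv P (0, 1) Y) (G_mult P (G_of_t P lam) (G_deriv P (1, 0) Y)) = G_zero P \<and>
      G_restrict_t0 P Y = u0"
    then obtain u where u: "u \<in> E_ML0 P" "Y = G_class P u" using G_L0_cases by blast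
    have "transport_residual v u \<in> N_L0 P"
      using Y unfolding u(2) lam by (simp add: transport_equation_iff[OF P v u(1)])
    then have res: "AE \<omega> in P. loc_negligible (\<lambda>\<epsilon> p. transport_residual v u \<epsilon> p \<omega>)"
      by (simp add: N_L0_iff)
    have "G_class P (\<lambda>\<epsilon> x \<omega>. u \<epsilon> (x, 0) \<omega>) = G_class P (\<lambda>\<epsilon> x \<omega>. U \<epsilon> (x, 0) \<omega>)"
      using Y U_init unfolding u(2) by (simp add: G_restrict_t0_class U u(1))
    then have init: "AE \<omega> in P. loc_negligible (\<lambda>\<epsilon> x. u \<epsilon> (x, 0) \<omega> - U \<epsilon> (x, 0) \<omega>)"
      by (simp add: G_class_eq_iff E_ML0_restrict_t0 U u(1) N_L0_iff)
    have "AE \<omega> in P. loc_negligible (\<lambda>\<epsilon> p. u \<epsilon> p \<omega> - U \<epsilon> p \<omega>)"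
      using char E_ML0_AE[OF u(1)] E_ML0_AE[OF U] E_ML0_AE[OF w] res init
    proof eventually_elim
      case (elim \<omega>)
      then interpret characteristics "\<lambda>\<epsilon> t. v \<epsilon> t \<omega>" "\<lambda>\<epsilon> t. L \<epsilon> t \<omega>" by simp
      have eqU: "(\<lambda>y. U \<epsilon> y \<omega>) = transported (\<lambda>\<epsilon> x. w \<epsilon> x \<omega>) \<epsilon>" for \<epsilon>
        by (simp add: fun_eq_iff transported_def U_def)
      show ?case
      proof (rule negligible_of_negligible_data[OF E_M_diff[OF elim(2,3)] _ elim(6)])
        show "loc_negligible (\<lambda>\<epsilon> p. partial_deriv (0, 1) (\<lambda>p. u \<epsilon> p \<omega> - U \<epsilon> p \<omega>) p +
            v \<epsilon> (snd p) \<omega> * partial_deriv (1, 0) (\<lambda>p. u \<epsilon> p \<omega> - U \<epsilon> p \<omega>) p)"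
        \<comment> \<open>By linearity the residual of the difference is that of \<open>u\<close>,
          as the residual of \<open>U\<close> vanishes; smoothness of both paths is what allows the
          derivative of the difference to be split.\<close>
        proof (rule loc_negligible_cong[OF elim(5)])
          fix \<epsilon> :: real and p :: "real \<times> real" assume e: "\<epsilon> \<in> {0<..1}"
          have "partial_deriv (0, 1) (\<lambda>y. U \<epsilon> y \<omega>) p +
              v \<epsilon> (snd p) \<omega> * partial_deriv (1, 0) (\<lambda>y. U \<epsilon> y \<omega>) p = 0"
            using transported_solves[OF elim(4) e] by (simp add: eqU)
          then show "transport_residual v u \<epsilon> p \<omega> =
              partial_deriv (0, 1) (\<lambda>p. u \<epsilon> p \<omega> - U \<epsilon> p \<omega>) p +
              v \<epsilon> (snd p) \<omega> * partial_deriv (1, 0) (\<lambda>p. u \<epsilon> p \<omega> - U \<epsilon> p \<omega>) p"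
            using E_M_C_infinity[OF elim(2) e] E_M_C_infinity[OF elim(3) e]
            by (simp add: C_infinity_partial_deriv_diff Basis_real_prod transport_residual_def algebra_simps)
        qed
      qed
    qed
    then have "(\<lambda>\<epsilon> p \<omega>. u \<epsilon> p \<omega> - U \<epsilon> p \<omega>) \<in> N_L0 P"
      by (simp add: N_L0_iff E_ML0_diff u(1) U)
    then show "Y = G_class P U" unfolding u(2) by (simp add: G_class_eq_iff u(1) U)
  qed
qed

end
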